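(* Let $\mathbb F$ be a field of characteristic not $2$, and let $(A,B)$ be a pair of skew-symmetric matrices of the same size over $\mathbb F$. Then $(A,B)$ has a regularizing decomposition: it is congruent over $\mathbb F$ to a direct sum \[ (\underline{\underline A},\underline{\underline B})\oplus (A_1,B_1)\oplus\dots\oplus(A_t,B_t), \] in which $(\underline{\underline A},\underline{\underline B})$ is a pair of nonsingular matrices of the same size and each $(A_i,B_i)$ is one of the pairs $\mathcal J_n$, $\mathcal K_n$, $\mathcal L_n$ with $n\in\{1,2,\dots\}$.
   Context: Two pairs $(A,B)$ and $(A',B')$ of square matrices of the same size over $\mathbb F$ are congruent if there exists a nonsingular matrix $S$ over $\mathbb F$ such that $(SAS^T,SBS^T)=(A',B')$. The direct sum of pairs is \[ (A,B)\oplus(A',B'):=\left(\begin{bmatrix}A&0\\0&A'\end{bmatrix},\begin{bmatrix}B&0\\0&B'\end{bmatrix}\right). \] $J_n(0)$ is the $n\times n$ singular Jordan block, with ones on the first subdiagonal and zeros elsewhere. For $n=1,2,\dots$, $L_n$ and $R_n$ are the $(n-1)\times n$ matrices \[ L_n:=\begin{bmatrix}1&0&&0\\&\ddots&\ddots\\0&&1&0\end{bmatrix},\qquad R_n:=\begin{bmatrix}0&1&&0\\&\ddots&\ddots\\0&&0&1\end{bmatrix}, \] i.e. $L_n=[I_{n-1}\;\,0]$ and $R_n=[0\;\,I_{n-1}]$. Define \[ \mathcal J_n:=\left(\begin{bmatrix}0&I_n\\-I_n&0\end{bmatrix},\begin{bmatrix}0&J_n(0)\\-J_n(0)^T&0\end{bmatrix}\right),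 \] \[ \mathcal K_n:=\left(\begin{bmatrix}0&J_n(0)\\-J_n(0)^T&0\end{bmatrix},\begin{bmatrix}0&I_n\\-I_n&0\end{bmatrix}\right), \] \[ \mathcal L_n:=\left(\begin{bmatrix}0&L_n\\-L_n^T&0\end{bmatrix},\begin{bmatrix}0&R_n\\-R_n^T&0\end{bmatrix}\right). \] The matrices of $\mathcal J_n$ and $\mathcal K_n$ are $2n\times 2n$, and those of $\mathcal L_n$ are $(2n-1)\times(2n-1)$; in particular, $\mathcal L_1=([0],[0])$. The pair $(\underline{\underline A},\underline{\underline B})$ may be empty (of size $0\times 0$), and $t=0$ is allowed. *)

theory Defs
  imports Jordan_Normal_Form.Matrix
begin

definition skew_symmetric_mat :: "'a::field mat \<Rightarrow> bool" where
  "skew_symmetric_mat A \<longleftrightarrow> square_mat A \<and> A\<^sup>T = - A"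

type_synonym 'a mat_pair = "'a mat \<times> 'a mat"

definition pair_carrier :: "nat \<Rightarrow> 'a mat_pair set" where
  "pair_carrier n = carrier_mat n n \<times> carrier_mat n n"

definition congruent_pairs :: "'a::field mat_pair \<Rightarrow> 'a mat_pair \<Rightarrow> bool" where
  "congruent_pairs P Q \<longleftrightarrow>
     (\<exists>n. P \<in> pair_carrier n \<and> Q \<in> pair_carrier n \<and>
       (\<exists>S \<in> carrier_mat n n. invertible_mat S \<and>
          (S * fst P * S\<^sup>T, S * snd P * S\<^sup>T) = Q))"

definition mat_dsum :: "'a::zero mat \<Rightarrow> 'a mat \<Rightarrow> 'a mat" where
  "mat_dsum A A' =
     four_block_mat A (0\<^sub>m (dim_row A) (dim_col A')) (0\<^sub>m (dim_row A') (dim_col A)) A'"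

definition pair_dsum :: "'a::zero mat_pair \<Rightarrow> 'a mat_pair \<Rightarrow> 'a mat_pair" where
  "pair_dsum P Q = (mat_dsum (fst P) (fst Q), mat_dsum (snd P) (snd Q))"

text \<open>The ones lie on the first subdiagonal, unlike in \<open>jordan_block\<close> of the
  Jordan normal form library.\<close>

definition sub_jordan_block :: "nat \<Rightarrow> 'a::zero_neq_one mat" where
  "sub_jordan_block n = mat n n (\<lambda>(i, j). if i = Suc j then 1 else 0)"

definition L_mat :: "nat \<Rightarrow> 'a::zero_neq_one mat" where
  "L_mat n = mat (n - 1) n (\<lambda>(i, j). if i = j then 1 else 0)"

definition R_mat :: "nat \<Rightarrow> 'a::zero_neq_one mat" where
  "R_mat n = mat (n - 1) n (\<lambda>(i, j). if j = Suc i then 1 else 0)"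

definition skew_block :: "'a::field mat \<Rightarrow> 'a mat" where
  "skew_block M =
     four_block_mat (0\<^sub>m (dim_row M) (dim_row M)) M (- M\<^sup>T) (0\<^sub>m (dim_col M) (dim_col M))"

definition J_pair :: "nat \<Rightarrow> 'a::field mat_pair" where
  "J_pair n = (skew_block (1\<^sub>m n), skew_block (sub_jordan_block n))"

definition K_pair :: "nat \<Rightarrow> 'a::field mat_pair" where
  "K_pair n = (skew_block (sub_jordan_block n), skew_block (1\<^sub>m n))"

definition L_pair :: "nat \<Rightarrow> 'a::field mat_pair" where
  "L_pair n = (skew_block (L_mat n), skew_block (R_mat n))"

definition singular_summands :: "'a::field mat_pair set" where
  "singular_summands = (\<Union>n\<in>{1..}. {J_pair n, K_pair n, L_pair n})"

text \<open>The regular part \<open>(A0, B0)\<close> may be of size \<open>0\<close>, where \<open>invertible_mat\<close> holds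
  trivially, and \<open>Ps\<close> may be empty.\<close>

definition regularizing_decomposition ::
  "'a::field mat_pair \<Rightarrow> 'a mat_pair \<Rightarrow> 'a mat_pair list \<Rightarrow> bool" where
  "regularizing_decomposition P P0 Ps \<longleftrightarrow>
     (\<exists>m. P0 \<in> pair_carrier m) \<and> invertible_mat (fst P0) \<and> invertible_mat (snd P0) \<and>
     set Ps \<subseteq> singular_summands \<and>
     congruent_pairs P (foldl pair_dsum P0 Ps)"

end

theory Submission
  imports Defs Jordan_Normal_Form.Determinant
begin

text \<open>
  A pair \<open>(A, B)\<close> of skew-symmetric matrices is read as a pair of alternating forms
  \<open>(x, y) \<mapsto> x \<bullet> A y\<close> and \<open>(x, y) \<mapsto> x \<bullet> B y\<close>. As long as one of the matrices is singular, a pair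
  \<open>\<J>\<^sub>k\<close>, \<open>\<K>\<^sub>k\<close> or \<open>\<L>\<^sub>k\<close> splits off as a direct summand (\<open>singular_splits_summand\<close>), and
  induction on the size gives the theorem.

  The summands are found from chains: sequences of vectors with \<open>A v\<^sub>i\<^sub>+\<^sub>1 = B v\<^sub>i\<close>. Since
  \<open>v\<^sub>i \<bullet> A v\<^sub>j\<close> depends only on \<open>i + j\<close> along a chain and the form alternates, the span of a
  chain is isotropic for both forms; here the characteristic enters. Each summand is the sum of
  two chains in duality, and a second chain dual to a given one comes from the solvability
  criterion for linear systems (\<open>chain_or_certificate\<close>): either the dual chain exists, or there is
  a certificate against it. A certificate is itself essentially a chain, so an extremal choice of
  the first chain excludes it.

  \<^item> Suppose that there is a closed chain, that is, a nonzero one with \<open>A v\<^sub>0 = 0\<close> that ends in the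
    kernel of \<open>B\<close>. Take one of minimal length. A certificate would yield a shorter closed chain,
    so the dual chain exists and \<open>\<L>\<^sub>k\<close> splits off (\<open>closed_chain_splits_L_pair\<close>).

  \<^item> Suppose that there is no closed chain and that \<open>A\<close> is singular. The chains that start with
    a nonzero vector of the kernel of \<open>A\<close> then have bounded length, because a linear relation in a long
    chain produces a closed one. Take one of maximal length. A certificate would prolong it, so the
    dual chain exists and \<open>\<K>\<^sub>k\<close> splits off (\<open>singular_splits_K_pair\<close>). If \<open>B\<close> is singular, the same
    argument for \<open>(B, A)\<close> gives \<open>\<J>\<^sub>k\<close>, since the reverse of a closed chain for \<open>(B, A)\<close> is a closed
    chain for \<open>(A, B)\<close>.

  That the subspace found is a direct summand requires only that its coordinate functionals extend to
  the whole space in such a way that both forms, with one argument in the subspace, are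
  combinations of these functionals (\<open>split_summand\<close>).
\<close>

section \<open>Linear systems over a field\<close>

lemma exists_kernel_vec:
  fixes M :: "'a::field mat"
  assumes M: "M \<in> carrier_mat r c" and "r < c"
  obtains x where "x \<in> carrier_vec c" "x \<noteq> 0\<^sub>v c" "M *\<^sub>v x = 0\<^sub>v r"
proof -
  let ?N = "mat\<^sub>r c c (\<lambda>i. if i = r then 0\<^sub>v c else if i < r then row M i else 0\<^sub>v c)"
  have "det ?N = 0"
    using M \<open>r < c\<close> by (intro det_row_0) auto
  then obtain x where x: "x \<in> carrier_vec c" "x \<noteq> 0\<^sub>v c" "?N *\<^sub>v x = 0\<^sub>v c"
    using det_0_iff_vec_prod_zero_field[of ?N c] by auto
  have "(M *\<^sub>v x) $ i = 0" if "i < r" for i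
  proof -
    have "(M *\<^sub>v x) $ i = (?N *\<^sub>v x) $ i" using that M \<open>r < c\<close> by auto
    then show ?thesis using x(3) that \<open>r < c\<close> by simp
  qed
  then have "M *\<^sub>v x = 0\<^sub>v r" using M by (intro eq_vecI) auto
  with x that show thesis by blast
qed

text \<open>The solvability criterion for linear systems, for finitely many linear functionals on a set \<open>W\<close>
  closed under the operation \<open>comb x c y\<close>, which stands for \<open>x + c y\<close>. Linearity with respect to
  this one operation is all that is used, so \<open>W\<close> may be any carrier set, for instance a set of
  sequences of vectors.\<close>

lemma functional_span_or_separated:
  fixes \<phi> :: "'i \<Rightarrow> 'v \<Rightarrow> 'a::field" and \<psi> :: "'v \<Rightarrow> 'a" and comb :: "'v \<Rightarrow> 'a \<Rightarrow> 'v \<Rightarrow> 'v"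
  assumes "finite I"
    and comb: "\<And>x c y. x \<in> W \<Longrightarrow> y \<in> W \<Longrightarrow> comb x c y \<in> W"
    and lin: "\<forall>i\<in>I. \<forall>x\<in>W. \<forall>y\<in>W. \<forall>c. \<phi> i (comb x c y) = \<phi> i x + c * \<phi> i y"
    and "\<forall>x\<in>W. \<forall>y\<in>W. \<forall>c. \<psi> (comb x c y) = \<psi> x + c * \<psi> y"
  shows "(\<exists>c. \<forall>x\<in>W. \<psi> x = (\<Sum>i\<in>I. c i * \<phi> i x)) \<or> (\<exists>x\<in>W. (\<forall>i\<in>I. \<phi> i x = 0) \<and> \<psi> x = 1)"
  using assms(1,3,4)
proof (induction I arbitrary: \<psi> rule: finite_induct)
  case empty
  show ?case
  proof (cases "\<forall>x\<in>W. \<psi> x = 0")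
    case False
    then obtain x where x: "x \<in> W" "\<psi> x \<noteq> 0" by blast
    \<comment> \<open>\<open>comb x (a - 1) x\<close> plays the role of the scalar multiple \<open>a x\<close>.\<close>
    have "\<psi> (comb x (1 / \<psi> x - 1) x) = 1"
      using x empty by (simp add: field_simps)
    then show ?thesis using comb[OF x(1) x(1)] by auto
  qed auto
next
  case (insert k I)
  note lin_k = bspec[OF insert.prems(1) insertI1]
  from insert.prems(1)
  have lin_I: "\<forall>i\<in>I. \<forall>x\<in>W. \<forall>y\<in>W. \<forall>c. \<phi> i (comb x c y) = \<phi> i x + c * \<phi> i y" by blast
  note lin_\<psi> = insert.prems(2)
  note IH = insert.IH[OF lin_I]
  from IH[OF lin_k]
  consider (dep) c where "\<forall>x\<in>W. \<phi> k x = (\<Sum>i\<in>I. c i * \<phi> i x)"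
    | (indep) z where "z \<in> W" "\<forall>i\<in>I. \<phi> i z = 0" "\<phi> k z = 1"
    by blast
  then show ?case
  proof cases
    case dep
    from IH[OF lin_\<psi>] show ?thesis
    proof (elim disjE exE bexE)
      fix d assume d: "\<forall>x\<in>W. \<psi> x = (\<Sum>i\<in>I. d i * \<phi> i x)"
      have "\<psi> x = (\<Sum>i\<in>insert k I. (d(k := 0)) i * \<phi> i x)" if "x \<in> W" for x
      proof -
        have "(\<Sum>i\<in>I. d i * \<phi> i x) = (\<Sum>i\<in>I. (d(k := 0)) i * \<phi> i x)"
          using insert.hyps by (intro sum.cong) auto
        then show ?thesis using d that insert.hyps by simp
      qed
      then show ?thesis by blast
    next
      fix x assume "x \<in> W" "(\<forall>i\<in>I. \<phi> i x = 0) \<and> \<psi> x = 1"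
      then show ?thesis using dep by (intro disjI2 bexI[of _ x]) auto
    qed
  next
    case indep
    let ?\<psi> = "\<lambda>x. \<psi> x - \<psi> z * \<phi> k x"
    have "\<forall>x\<in>W. \<forall>y\<in>W. \<forall>c. ?\<psi> (comb x c y) = ?\<psi> x + c * ?\<psi> y"
      using lin_\<psi> lin_k by (simp add: algebra_simps)
    from IH[OF this] show ?thesis
    proof (elim disjE exE bexE)
      fix d assume d: "\<forall>x\<in>W. \<psi> x - \<psi> z * \<phi> k x = (\<Sum>i\<in>I. d i * \<phi> i x)"
      have "\<psi> x = (\<Sum>i\<in>insert k I. (d(k := \<psi> z)) i * \<phi> i x)" if "x \<in> W" for x
      proof -
        have "(\<Sum>i\<in>I. d i * \<phi> i x) = (\<Sum>i\<in>I. (d(k := \<psi> z)) i * \<phi> i x)"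
          using insert.hyps by (intro sum.cong) auto
        then show ?thesis using bspec[OF d that] insert.hyps by (simp add: algebra_simps)
      qed
      then show ?thesis by blast
    next
      fix x assume x: "x \<in> W" "(\<forall>i\<in>I. \<phi> i x = 0) \<and> \<psi> x - \<psi> z * \<phi> k x = 1"
      let ?y = "comb x (- \<phi> k x) z"
      have "\<phi> i ?y = 0" if "i \<in> I" for i
        using x indep lin_I that by simp
      moreover have "\<phi> k ?y = 0" using x indep lin_k by simp
      moreover have "\<psi> ?y = 1"
        using x indep lin_\<psi> by (simp add: algebra_simps)
      ultimately show ?thesis using comb[OF x(1) indep(1)] by blast
    qed
  qed
qed

lemma invertible_matE:
  assumes "invertible_mat S" "S \<in> carrier_mat n n"
  obtains T where "T \<in> carrier_mat n n" "S * T = 1\<^sub>m n" "T * S = 1\<^sub>m n"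
proof -
  obtain T where T: "S * T = 1\<^sub>m (dim_row S)" "T * S = 1\<^sub>m (dim_row T)"
    using assms(1) unfolding invertible_mat_def inverts_mat_def by blast
  have "dim_col T = n"
    using arg_cong[OF T(1), of dim_col] assms(2) by simp
  moreover have "dim_row T = n"
    using arg_cong[OF T(2), of dim_col] assms(2) by simp
  ultimately have "T \<in> carrier_mat n n" by auto
  then show thesis using T assms(2) by (intro that[of T]) auto
qed

lemma invertible_matI:
  assumes "S \<in> carrier_mat n n" "T \<in> carrier_mat n n" "S * T = 1\<^sub>m n" "T * S = 1\<^sub>m n"
  shows "invertible_mat S"
proof -
  have "inverts_mat S T" "inverts_mat T S" using assms unfolding inverts_mat_def by auto
  moreover have "square_mat S" using assms(1) by simp
  ultimately show ?thesis unfolding invertible_mat_def by blast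
qed

lemma not_invertible_kernel:
  fixes A :: "'a::field mat"
  assumes A: "A \<in> carrier_mat n n" and "\<not> invertible_mat A"
  obtains x where "x \<in> carrier_vec n" "x \<noteq> 0\<^sub>v n" "A *\<^sub>v x = 0\<^sub>v n"
proof -
  have "det A = 0"
  proof (rule ccontr)
    assume "det A \<noteq> 0"
    from det_non_zero_imp_unit[OF A this, of "()"]
    obtain T where "T \<in> carrier_mat n n" "A * T = 1\<^sub>m n" "T * A = 1\<^sub>m n"
      unfolding Units_def ring_mat_def by auto
    then show False using invertible_matI[OF A] assms(2) by blast
  qed
  then show thesis using det_0_iff_vec_prod_zero_field[OF A] that by blast
qed

section \<open>Congruence and direct sums of pairs\<close>

lemma mat_dsum_carrier:
  "M \<in> carrier_mat n n \<Longrightarrow> N \<in> carrier_mat k k \<Longrightarrow> mat_dsum M N \<in> carrier_mat (n + k) (n + k)"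
  by (auto simp: mat_dsum_def)

lemma mat_dsum_mult:
  fixes M M' N N' :: "'a::field mat"
  assumes "M \<in> carrier_mat n n" "M' \<in> carrier_mat n n" "N \<in> carrier_mat k k" "N' \<in> carrier_mat k k"
  shows "mat_dsum M N * mat_dsum M' N' = mat_dsum (M * M') (N * N')"
proof -
  have "mat_dsum M N * mat_dsum M' N' = four_block_mat (M * M' + 0\<^sub>m n k * 0\<^sub>m k n)
    (M * 0\<^sub>m n k + 0\<^sub>m n k * N') (0\<^sub>m k n * M' + N * 0\<^sub>m k n) (0\<^sub>m k n * 0\<^sub>m n k + N * N')"
    unfolding mat_dsum_def using assms
    by (simp only: carrier_matD, intro mult_four_block_mat) auto
  also have "\<dots> = mat_dsum (M * M') (N * N')"
    using assms by (simp add: mat_dsum_def)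
  finally show ?thesis .
qed

lemma mat_dsum_transpose:
  assumes "M \<in> carrier_mat n n" "N \<in> carrier_mat k k"
  shows "(mat_dsum M N)\<^sup>T = mat_dsum (M\<^sup>T) (N\<^sup>T)"
  unfolding mat_dsum_def using assms by (intro eq_matI) auto

lemma mat_dsum_one: "mat_dsum (1\<^sub>m n) (1\<^sub>m k) = 1\<^sub>m (n + k)"
  unfolding mat_dsum_def by (intro eq_matI) auto

lemma congruent_pairs_refl:
  assumes "P \<in> pair_carrier n"
  shows "congruent_pairs P P"
proof -
  have "fst P \<in> carrier_mat n n" "snd P \<in> carrier_mat n n"
    using assms by (auto simp: pair_carrier_def)
  then have "(1\<^sub>m n * fst P * (1\<^sub>m n)\<^sup>T, 1\<^sub>m n * snd P * (1\<^sub>m n)\<^sup>T) = P" by simp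
  moreover have "invertible_mat (1\<^sub>m n :: 'a mat)" by (rule invertible_matI[of _ n "1\<^sub>m n"]) auto
  ultimately show ?thesis
    unfolding congruent_pairs_def using assms one_carrier_mat by blast
qed

lemma congruent_pairs_swap:
  assumes "congruent_pairs (A, B) (A', B')"
  shows "congruent_pairs (B, A) (B', A')"
  using assms unfolding congruent_pairs_def pair_carrier_def by auto

lemma congruent_pairs_trans:
  assumes "congruent_pairs P Q" "congruent_pairs Q R"
  shows "congruent_pairs P R"
proof -
  obtain n S where P: "P \<in> pair_carrier n" and Q: "Q \<in> pair_carrier n"
    and S: "S \<in> carrier_mat n n" "invertible_mat S" "(S * fst P * S\<^sup>T, S * snd P * S\<^sup>T) = Q"
    using assms(1) unfolding congruent_pairs_def by blast
  obtain m S' where "Q \<in> pair_carrier m" and R: "R \<in> pair_carrier m"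
    and S': "S' \<in> carrier_mat m m" "invertible_mat S'" "(S' * fst Q * S'\<^sup>T, S' * snd Q * S'\<^sup>T) = R"
    using assms(2) unfolding congruent_pairs_def by blast
  have m: "m = n" using Q \<open>Q \<in> pair_carrier m\<close> by (auto simp: pair_carrier_def)
  note S' = S'[unfolded m] and R = R[unfolded m]
  obtain T where T: "T \<in> carrier_mat n n" "S * T = 1\<^sub>m n" "T * S = 1\<^sub>m n"
    using invertible_matE[OF S(2,1)] .
  obtain T' where T': "T' \<in> carrier_mat n n" "S' * T' = 1\<^sub>m n" "T' * S' = 1\<^sub>m n"
    using invertible_matE[OF S'(2,1)] .
  have "(S' * S) * (T * T') = S' * ((S * T) * T')"
    using S(1) S'(1) T(1) T'(1) by (simp add: assoc_mult_mat[where n\<^sub>1 = n and n\<^sub>2 = n and n\<^sub>3 = n and n\<^sub>4 = n])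
  then have 1: "(S' * S) * (T * T') = 1\<^sub>m n" using T T' by simp
  have "(T * T') * (S' * S) = T * ((T' * S') * S)"
    using S(1) S'(1) T(1) T'(1) by (simp add: assoc_mult_mat[where n\<^sub>1 = n and n\<^sub>2 = n and n\<^sub>3 = n and n\<^sub>4 = n])
  then have 2: "(T * T') * (S' * S) = 1\<^sub>m n" using T T' S by simp
  have inv: "invertible_mat (S' * S)"
    by (rule invertible_matI[OF _ _ 1 2]) (use S(1) S'(1) T(1) T'(1) in auto)
  have "(S' * S) * M * (S' * S)\<^sup>T = S' * (S * M * S\<^sup>T) * S'\<^sup>T" if "M \<in> carrier_mat n n" for M
    using S(1) S'(1) that
    by (simp add: transpose_mult[where nr = n and n = n and nc = n]
      assoc_mult_mat[where n\<^sub>1 = n and n\<^sub>2 = n and n\<^sub>3 = n and n\<^sub>4 = n])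
  then have "((S' * S) * fst P * (S' * S)\<^sup>T, (S' * S) * snd P * (S' * S)\<^sup>T) = R"
    using P S(3) S'(3) by (auto simp: pair_carrier_def)
  then show ?thesis
    unfolding congruent_pairs_def using P R inv S(1) S'(1) mult_carrier_mat by blast
qed

lemma congruent_pairs_dsum_left:
  assumes "congruent_pairs P P'" and Q: "Q \<in> pair_carrier k"
  shows "congruent_pairs (pair_dsum P Q) (pair_dsum P' Q)"
proof -
  obtain n S where P: "P \<in> pair_carrier n" and P': "P' \<in> pair_carrier n"
    and S: "S \<in> carrier_mat n n" "invertible_mat S" "(S * fst P * S\<^sup>T, S * snd P * S\<^sup>T) = P'"
    using assms(1) unfolding congruent_pairs_def by blast
  obtain T where T: "T \<in> carrier_mat n n" "S * T = 1\<^sub>m n" "T * S = 1\<^sub>m n"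
    using invertible_matE[OF S(2,1)] .
  let ?S = "mat_dsum S (1\<^sub>m k)"
  have inv: "invertible_mat ?S"
    by (rule invertible_matI[of _ "n + k" "mat_dsum T (1\<^sub>m k)"])
      (use S(1) T in \<open>auto simp: mat_dsum_mult[where n = n and k = k] mat_dsum_one intro!: mat_dsum_carrier\<close>)
  have "?S * mat_dsum M N * ?S\<^sup>T = mat_dsum (S * M * S\<^sup>T) N"
    if "M \<in> carrier_mat n n" "N \<in> carrier_mat k k" for M N
    using that S(1) by (simp add: mat_dsum_transpose[where n = n and k = k] mat_dsum_mult[where n = n and k = k])
  then have "(?S * fst (pair_dsum P Q) * ?S\<^sup>T, ?S * snd (pair_dsum P Q) * ?S\<^sup>T) = pair_dsum P' Q"
    using P Q S(3) by (auto simp: pair_carrier_def pair_dsum_def)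
  moreover have "pair_dsum X Q \<in> pair_carrier (n + k)" if "X \<in> pair_carrier n" for X
    using that Q by (auto simp: pair_carrier_def pair_dsum_def intro!: mat_dsum_carrier)
  moreover have "?S \<in> carrier_mat (n + k) (n + k)" using S(1) by (intro mat_dsum_carrier) auto
  ultimately show ?thesis
    unfolding congruent_pairs_def using P P' inv by blast
qed

section \<open>Dual systems\<close>

text \<open>Vectors \<open>u\<^sub>0, \<dots>, u\<^sub>k\<^sub>-\<^sub>1\<close> of dimension \<open>n\<close> together with biorthogonal vectors
  \<open>\<phi>\<^sub>0, \<dots>, \<phi>\<^sub>k\<^sub>-\<^sub>1\<close>. The latter represent linear functionals that restrict to the coordinates on the
  span of the \<open>u\<^sub>i\<close>. Values at indices from \<open>k\<close> on are irrelevant.\<close>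

definition dual_system :: "nat \<Rightarrow> nat \<Rightarrow> (nat \<Rightarrow> 'a::field vec) \<Rightarrow> (nat \<Rightarrow> 'a vec) \<Rightarrow> bool" where
  "dual_system n k u \<phi> \<longleftrightarrow> (\<forall>i<k. u i \<in> carrier_vec n \<and> \<phi> i \<in> carrier_vec n) \<and>
     (\<forall>i<k. \<forall>j<k. \<phi> i \<bullet> u j = (if i = j then 1 else 0))"

text \<open>The matrix of the bilinear form \<open>x \<bullet> A y\<close> with respect to \<open>u\<^sub>0, \<dots>, u\<^sub>k\<^sub>-\<^sub>1\<close>.\<close>

definition gram :: "nat \<Rightarrow> (nat \<Rightarrow> 'a::field vec) \<Rightarrow> 'a mat \<Rightarrow> 'a mat" where
  "gram k u A = mat k k (\<lambda>(i, j). u i \<bullet> (A *\<^sub>v u j))"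

lemma dual_system_le:
  assumes "dual_system n k u \<phi>"
  shows "k \<le> n"
proof (rule ccontr)
  assume "\<not> k \<le> n"
  let ?M = "mat n k (\<lambda>(i, j). u j $ i)"
  from \<open>\<not> k \<le> n\<close> have "n < k" by simp
  then obtain x where x: "x \<in> carrier_vec k" "x \<noteq> 0\<^sub>v k" "?M *\<^sub>v x = 0\<^sub>v n"
    using exists_kernel_vec[of ?M n k] by auto
  have "x $ i = 0" if "i < k" for i
  proof -
    let ?R = "mat k n (\<lambda>(i, j). \<phi> i $ j)"
    have u: "u j \<in> carrier_vec n" "\<phi> j \<in> carrier_vec n" if "j < k" for j
      using assms that unfolding dual_system_def by auto
    have "row ?R i = \<phi> i" if "i < k" for i
      using u[OF that] that by (intro eq_vecI) auto
    moreover have "col ?M j = u j" if "j < k" for j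
      using u[OF that] that by (intro eq_vecI) auto
    ultimately have "?R * ?M = 1\<^sub>m k"
      using assms unfolding dual_system_def by (intro eq_matI) auto
    then have "x = ?R *\<^sub>v (?M *\<^sub>v x)"
      using x(1) by (metis assoc_mult_mat_vec mat_carrier one_mult_mat_vec)
    also have "\<dots> = 0\<^sub>v k" unfolding x(3) by (intro eq_vecI) auto
    finally show ?thesis using that by simp
  qed
  with x(1,2) show False by auto
qed

lemma dual_system_extend_one:
  assumes d: "dual_system n k u \<phi>" and "k < n"
  obtains w \<psi> where "dual_system n (Suc k) (u(k := w)) (\<phi>(k := \<psi>))"
proof -
  have u: "u j \<in> carrier_vec n" "\<phi> j \<in> carrier_vec n" if "j < k" for j
    using d that unfolding dual_system_def by auto
  let ?M = "\<lambda>v. mat k n (\<lambda>(i, j). v i $ j)"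
  have row: "row (?M v) i = v i" if "i < k" "v i \<in> carrier_vec n" for v i
    using that by (intro eq_vecI) auto
  obtain w where w: "w \<in> carrier_vec n" "w \<noteq> 0\<^sub>v n" "?M \<phi> *\<^sub>v w = 0\<^sub>v k"
    using exists_kernel_vec[of "?M \<phi>" k n] \<open>k < n\<close> by auto
  have \<phi>w: "\<phi> i \<bullet> w = 0" if "i < k" for i
  proof -
    have "\<phi> i \<bullet> w = (?M \<phi> *\<^sub>v w) $ i" using row[of i \<phi>] u that by simp
    then show ?thesis using w(3) that by simp
  qed
  have "(\<exists>c. \<forall>x\<in>carrier_vec n. w \<bullet> x = (\<Sum>i\<in>{..<k}. c i * (u i \<bullet> x)))
    \<or> (\<exists>x\<in>carrier_vec n. (\<forall>i\<in>{..<k}. u i \<bullet> x = 0) \<and> w \<bullet> x = 1)"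
    by (rule functional_span_or_separated[where comb = "\<lambda>x c y. x + c \<cdot>\<^sub>v y"])
      (use u w in \<open>auto simp: scalar_prod_add_distrib[where n = n]\<close>)
  then show thesis
  proof (elim disjE exE bexE)
    fix c assume c: "\<forall>x\<in>carrier_vec n. w \<bullet> x = (\<Sum>i\<in>{..<k}. c i * (u i \<bullet> x))"
    \<comment> \<open>Pairing with \<open>\<phi> j\<close> shows that every coefficient vanishes.\<close>
    have "c j = 0" if "j < k" for j
    proof -
      have "(\<Sum>i\<in>{..<k}. c i * (u i \<bullet> \<phi> j)) = (\<Sum>i\<in>{..<k}. if i = j then c i else 0)"
      proof (intro sum.cong refl)
        fix i assume "i \<in> {..<k}"
        then have "u i \<bullet> \<phi> j = \<phi> j \<bullet> u i" using u that by (intro comm_scalar_prod) auto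
        then show "c i * (u i \<bullet> \<phi> j) = (if i = j then c i else 0)"
          using d that \<open>i \<in> _\<close> unfolding dual_system_def by auto
      qed
      also have "\<dots> = c j" using that by simp
      finally have "w \<bullet> \<phi> j = c j" using c u that by simp
      moreover have "w \<bullet> \<phi> j = \<phi> j \<bullet> w" using u w that by (intro comm_scalar_prod) auto
      ultimately show ?thesis using \<phi>w that by simp
    qed
    then have wx: "w \<bullet> x = 0" if "x \<in> carrier_vec n" for x using c that by simp
    have "w $ i = 0" if "i < n" for i
      using wx[of "unit_vec n i"] w(1) that by simp
    then have "w = 0\<^sub>v n" using w(1) by auto
    then show thesis using w(2) by simp
  next
    fix \<psi> assume "\<psi> \<in> carrier_vec n" "(\<forall>i\<in>{..<k}. u i \<bullet> \<psi> = 0) \<and> w \<bullet> \<psi> = 1"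
    then have "dual_system n (Suc k) (u(k := w)) (\<phi>(k := \<psi>))"
      using d w \<phi>w u unfolding dual_system_def
      by (auto simp: less_Suc_eq comm_scalar_prod[of \<psi> n])
    then show thesis by (rule that)
  qed
qed

lemma dual_system_extend:
  assumes "dual_system n k u \<phi>"
  shows "\<exists>u' \<phi>'. dual_system n n u' \<phi>' \<and> (\<forall>i<k. u' i = u i \<and> \<phi>' i = \<phi> i)"
  using dual_system_le[OF assms] assms
proof (induction k arbitrary: u \<phi> rule: inc_induct)
  case (step k)
  from dual_system_extend_one[OF step.prems \<open>k < n\<close>]
  obtain w \<psi> where "dual_system n (Suc k) (u(k := w)) (\<phi>(k := \<psi>))" .
  from step.IH[OF this] obtain u' \<phi>' where
    "dual_system n n u' \<phi>'" "\<forall>i<Suc k. u' i = (u(k := w)) i \<and> \<phi>' i = (\<phi>(k := \<psi>)) i"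
    by blast
  then show ?case by (intro exI[of _ u'] exI[of _ \<phi>']) auto
qed blast

lemma congruent_gram:
  assumes A: "A \<in> carrier_mat n n" and B: "B \<in> carrier_mat n n" and d: "dual_system n n s t"
  shows "congruent_pairs (A, B) (gram n s A, gram n s B)"
proof -
  have s: "s j \<in> carrier_vec n" "t j \<in> carrier_vec n" if "j < n" for j
    using d that unfolding dual_system_def by auto
  let ?S = "mat n n (\<lambda>(i, j). s i $ j)" and ?T = "mat n n (\<lambda>(i, j). t j $ i)"
  have row_S: "row ?S i = s i" if "i < n" for i
    using s[OF that] that by (intro eq_vecI) auto
  have col_T: "col ?T i = t i" if "i < n" for i
    using s[OF that] that by (intro eq_vecI) auto
  have "?S * ?T = 1\<^sub>m n"
  proof (intro eq_matI)
    fix i j assume "i < dim_row (1\<^sub>m n :: 'a mat)" "j < dim_col (1\<^sub>m n :: 'a mat)"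
    then have ij: "i < n" "j < n" by auto
    then have "(?S * ?T) $$ (i, j) = row ?S i \<bullet> col ?T j" by simp
    also have "\<dots> = t j \<bullet> s i"
      unfolding row_S[OF ij(1)] col_T[OF ij(2)] using s ij by (intro comm_scalar_prod) auto
    finally show "(?S * ?T) $$ (i, j) = 1\<^sub>m n $$ (i, j)"
      using d ij unfolding dual_system_def by auto
  qed auto
  note ST = this
  have "?T * ?S = 1\<^sub>m n" by (rule mat_mult_left_right_inverse[OF _ _ ST]) auto
  with ST have "inverts_mat ?S ?T" "inverts_mat ?T ?S" unfolding inverts_mat_def by simp_all
  then have inv: "invertible_mat ?S"
    unfolding invertible_mat_def by (simp only: square_mat.simps dim_row_mat dim_col_mat) blast
  have "?S * M * ?S\<^sup>T = gram n s M" if M: "M \<in> carrier_mat n n" for M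
  proof -
    have "?S * M * ?S\<^sup>T = ?S * (M * ?S\<^sup>T)" using M by (intro assoc_mult_mat) auto
    also have "\<dots> = gram n s M"
    proof (intro eq_matI)
      fix i j assume "i < dim_row (gram n s M)" "j < dim_col (gram n s M)"
      then have ij: "i < n" "j < n" by (auto simp: gram_def)
      have "col (M * ?S\<^sup>T) j = M *\<^sub>v s j"
        using ij M row_S[of j] by (intro eq_vecI) auto
      then show "(?S * (M * ?S\<^sup>T)) $$ (i, j) = gram n s M $$ (i, j)"
        using ij M row_S[of i] by (simp add: gram_def)
    qed (auto simp: gram_def)
    finally show ?thesis .
  qed
  from this[OF A] this[OF B] have "(?S * fst (A, B) * ?S\<^sup>T, ?S * snd (A, B) * ?S\<^sup>T) = (gram n s A, gram n s B)"
    by (simp only: fst_conv snd_conv)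
  moreover have "gram n s M \<in> carrier_mat n n" for M by (simp add: gram_def)
  moreover have "?S \<in> carrier_mat n n" by simp
  ultimately show ?thesis
    unfolding congruent_pairs_def pair_carrier_def using A B inv by blast
qed

section \<open>Pairs of alternating forms\<close>

lemma skew_form_swap:
  fixes A :: "'a::field mat"
  assumes "A \<in> carrier_mat n n" "A\<^sup>T = - A" "x \<in> carrier_vec n" "y \<in> carrier_vec n"
  shows "x \<bullet> (A *\<^sub>v y) = - (y \<bullet> (A *\<^sub>v x))"
proof -
  have "x \<bullet> (A *\<^sub>v y) = (A\<^sup>T *\<^sub>v x) \<bullet> y"
    using transpose_vec_mult_scalar[OF assms(1,4,3)] by simp
  also have "\<dots> = - ((A *\<^sub>v x) \<bullet> y)"
    using assms by simp
  also have "(A *\<^sub>v x) \<bullet> y = y \<bullet> (A *\<^sub>v x)"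
    using assms by (intro comm_scalar_prod[of _ n]) auto
  finally show ?thesis .
qed

lemma skew_gram:
  assumes "A \<in> carrier_mat n n" "A\<^sup>T = - A" "\<And>i. i < k \<Longrightarrow> u i \<in> carrier_vec n"
  shows "skew_symmetric_mat (gram k u A)"
  unfolding skew_symmetric_mat_def
proof
  show "(gram k u A)\<^sup>T = - gram k u A"
    by (intro eq_matI) (auto simp: gram_def intro!: skew_form_swap[OF assms(1,2)] assms(3))
qed (simp add: gram_def)

lemma gram_mat_dsum:
  assumes "\<And>i j. i < m \<Longrightarrow> j < k \<Longrightarrow> s i \<bullet> (A *\<^sub>v s (m + j)) = 0"
    and "\<And>i j. i < m \<Longrightarrow> j < k \<Longrightarrow> s (m + j) \<bullet> (A *\<^sub>v s i) = 0"
  shows "gram (m + k) s A = mat_dsum (gram m s A) (gram k (\<lambda>i. s (m + i)) A)"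
proof (intro eq_matI)
  fix i j
  assume "i < dim_row (mat_dsum (gram m s A) (gram k (\<lambda>i. s (m + i)) A))"
    "j < dim_col (mat_dsum (gram m s A) (gram k (\<lambda>i. s (m + i)) A))"
  then have "i < m + k" "j < m + k" by (auto simp: gram_def mat_dsum_def)
  then show "gram (m + k) s A $$ (i, j) = mat_dsum (gram m s A) (gram k (\<lambda>i. s (m + i)) A) $$ (i, j)"
    using assms(1)[of i "j - m"] assms(2)[of j "i - m"]
    by (auto simp: gram_def mat_dsum_def)
qed (auto simp: gram_def mat_dsum_def)

text \<open>The first \<open>k\<close> terms of \<open>v\<close> form a chain of the pencil: \<open>A\<close> maps each term but the first to the
  image of its predecessor under \<open>B\<close>. No condition is imposed on \<open>A v\<^sub>0\<close> and \<open>B v\<^sub>k\<^sub>-\<^sub>1\<close>.\<close>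

definition chain :: "'a::field mat \<Rightarrow> 'a mat \<Rightarrow> nat \<Rightarrow> nat \<Rightarrow> (nat \<Rightarrow> 'a vec) \<Rightarrow> bool" where
  "chain A B n k v \<longleftrightarrow> (\<forall>i<k. v i \<in> carrier_vec n) \<and> (\<forall>i. Suc i < k \<longrightarrow> A *\<^sub>v v (Suc i) = B *\<^sub>v v i)"

lemma chainD:
  assumes "chain A B n k v"
  shows "i < k \<Longrightarrow> v i \<in> carrier_vec n" "Suc i < k \<Longrightarrow> A *\<^sub>v v (Suc i) = B *\<^sub>v v i"
  using assms unfolding chain_def by auto

text \<open>A chain that starts in the kernel of \<open>A\<close> and ends in the kernel of \<open>B\<close>, not all of whose terms
  vanish.\<close>

definition closed_chain :: "'a::field mat \<Rightarrow> 'a mat \<Rightarrow> nat \<Rightarrow> nat \<Rightarrow> (nat \<Rightarrow> 'a vec) \<Rightarrow> bool" where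
  "closed_chain A B n k v \<longleftrightarrow> chain A B n k v \<and> 0 < k \<and> A *\<^sub>v v 0 = 0\<^sub>v n \<and> B *\<^sub>v v (k - 1) = 0\<^sub>v n \<and>
     (\<exists>i<k. v i \<noteq> 0\<^sub>v n)"

lemma closed_chain_reverse:
  assumes "closed_chain A B n k v"
  shows "closed_chain B A n k (\<lambda>i. v (k - 1 - i))"
proof -
  have c: "chain A B n k v" and k: "0 < k" and ends: "A *\<^sub>v v 0 = 0\<^sub>v n" "B *\<^sub>v v (k - 1) = 0\<^sub>v n"
    using assms unfolding closed_chain_def by auto
  obtain i where i: "i < k" "v i \<noteq> 0\<^sub>v n" using assms unfolding closed_chain_def by blast
  have "B *\<^sub>v v (k - 1 - Suc j) = A *\<^sub>v v (k - 1 - j)" if "Suc j < k" for j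
  proof -
    have "k - 1 - j = Suc (k - 1 - Suc j)" using that by simp
    then show ?thesis using chainD(2)[OF c, of "k - 1 - Suc j"] that by simp
  qed
  then have "chain B A n k (\<lambda>i. v (k - 1 - i))"
    using chainD(1)[OF c] k unfolding chain_def by simp
  moreover have "k - 1 - i < k" "v (k - 1 - (k - 1 - i)) \<noteq> 0\<^sub>v n" using i by auto
  ultimately show ?thesis
    unfolding closed_chain_def using k ends by auto
qed

text \<open>A pair of skew-symmetric matrices of size \<open>n\<close> over a field of characteristic other than 2.\<close>

locale skew_pair =
  fixes A B :: "'a::field mat" and n :: nat
  assumes A: "A \<in> carrier_mat n n" and B: "B \<in> carrier_mat n n"
    and skew_A: "A\<^sup>T = - A" and skew_B: "B\<^sup>T = - B"
    and two: "(2 :: 'a) \<noteq> 0"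
begin

lemmas swap_A = skew_form_swap[OF A skew_A] and swap_B = skew_form_swap[OF B skew_B]

lemma mult_carrier [simp]:
  "x \<in> carrier_vec n \<Longrightarrow> A *\<^sub>v x \<in> carrier_vec n" "x \<in> carrier_vec n \<Longrightarrow> B *\<^sub>v x \<in> carrier_vec n"
  using A B by auto

lemma mult_zero [simp]: "A *\<^sub>v 0\<^sub>v n = 0\<^sub>v n" "B *\<^sub>v 0\<^sub>v n = 0\<^sub>v n"
  using A B by auto

lemma eq_uminus_self: "(x :: 'a) = - x \<Longrightarrow> x = 0"
proof -
  assume "x = - x"
  then have "2 * x = 0" by (metis add.right_inverse mult_2)
  then show "x = 0" using two by simp
qed

lemma alternating:
  "x \<in> carrier_vec n \<Longrightarrow> x \<bullet> (A *\<^sub>v x) = 0" "x \<in> carrier_vec n \<Longrightarrow> x \<bullet> (B *\<^sub>v x) = 0"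
  using eq_uminus_self swap_A[of x x] swap_B[of x x] by blast+

text \<open>If both forms with one argument in the span of the \<open>u\<^sub>i\<close> vanish on the common kernel of the dual
  functionals \<open>\<phi>\<^sub>j\<close>, then this kernel is a complement that is orthogonal for both forms.\<close>

lemma split_summand:
  assumes d: "dual_system n k u \<phi>"
    and ann: "\<And>x i. x \<in> carrier_vec n \<Longrightarrow> \<forall>j<k. \<phi> j \<bullet> x = 0 \<Longrightarrow> i < k \<Longrightarrow>
      u i \<bullet> (A *\<^sub>v x) = 0 \<and> u i \<bullet> (B *\<^sub>v x) = 0"
  shows "\<exists>P\<in>pair_carrier (n - k). skew_symmetric_mat (fst P) \<and> skew_symmetric_mat (snd P) \<and>
    congruent_pairs (A, B) (pair_dsum P (gram k u A, gram k u B))"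
proof -
  from dual_system_extend[OF d] obtain u' \<phi>' where d': "dual_system n n u' \<phi>'"
    and ext: "\<And>i. i < k \<Longrightarrow> u' i = u i \<and> \<phi>' i = \<phi> i" by blast
  define m where "m = n - k"
  have n: "n = m + k" using dual_system_le[OF d] by (simp add: m_def)
  \<comment> \<open>The split summand comes last in the direct sum, but the extended system starts with it.\<close>
  let ?rot = "\<lambda>i. if i < m then k + i else i - m"
  let ?s = "\<lambda>i. u' (?rot i)" and ?t = "\<lambda>i. \<phi>' (?rot i)"
  have d'': "dual_system n n ?s ?t"
    unfolding dual_system_def
  proof (intro conjI allI impI)
    fix i assume i: "i < n"
    from i have "?rot i < n" using n by auto
    then show "?s i \<in> carrier_vec n" "?t i \<in> carrier_vec n"
      using d' unfolding dual_system_def by auto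
    fix j assume "j < n"
    then have "?rot j < n" "?rot i = ?rot j \<longleftrightarrow> i = j" using i n by auto
    then show "?t i \<bullet> ?s j = (if i = j then 1 else 0)"
      using d' \<open>?rot i < n\<close> unfolding dual_system_def by simp
  qed
  have carr: "?s i \<in> carrier_vec n" if "i < n" for i
    using d'' that unfolding dual_system_def by blast
  have tail: "?s (m + i) = u i" if "i < k" for i using ext[OF that] by simp
  have right: "u j \<bullet> (A *\<^sub>v ?s i) = 0 \<and> u j \<bullet> (B *\<^sub>v ?s i) = 0" if "i < m" "j < k" for i j
  proof (rule ann)
    show "\<forall>j<k. \<phi> j \<bullet> ?s i = 0"
    proof (intro allI impI)
      fix l assume "l < k"
      then have "\<phi> l = \<phi>' l" "l < n" "k + i < n" "l \<noteq> k + i" using ext that n by auto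
      then show "\<phi> l \<bullet> ?s i = 0" using d' that unfolding dual_system_def by simp
    qed
    show "?s i \<in> carrier_vec n" using that n by (intro carr) auto
  qed (use that in auto)
  have left: "?s i \<bullet> (A *\<^sub>v u j) = 0 \<and> ?s i \<bullet> (B *\<^sub>v u j) = 0" if "i < m" "j < k" for i j
  proof -
    have "?s i \<in> carrier_vec n" using that n by (intro carr) auto
    moreover have "u j \<in> carrier_vec n" using d that unfolding dual_system_def by blast
    ultimately show ?thesis
      using right[OF that] swap_A[of "?s i" "u j"] swap_B[of "?s i" "u j"] by simp
  qed
  have tail_gram: "gram k (\<lambda>i. ?s (m + i)) M = gram k u M" for M
    unfolding gram_def using tail by (intro eq_matI) auto
  have gA: "gram n ?s A = mat_dsum (gram m ?s A) (gram k u A)"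
    unfolding tail_gram[symmetric] unfolding n
    by (rule gram_mat_dsum; unfold tail) (use left right in auto)
  have gB: "gram n ?s B = mat_dsum (gram m ?s B) (gram k u B)"
    unfolding tail_gram[symmetric] unfolding n
    by (rule gram_mat_dsum; unfold tail) (use left right in auto)
  show ?thesis
  proof (intro bexI[of _ "(gram m ?s A, gram m ?s B)"] conjI)
    show "congruent_pairs (A, B) (pair_dsum (gram m ?s A, gram m ?s B) (gram k u A, gram k u B))"
      using congruent_gram[OF A B d''] unfolding gA gB pair_dsum_def by simp
    show "(gram m ?s A, gram m ?s B) \<in> pair_carrier (n - k)"
      by (simp add: pair_carrier_def gram_def m_def)
    show "skew_symmetric_mat (fst (gram m ?s A, gram m ?s B))"
      unfolding fst_conv by (rule skew_gram[OF A skew_A]) (rule carr, use n in auto)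
    show "skew_symmetric_mat (snd (gram m ?s A, gram m ?s B))"
      unfolding snd_conv by (rule skew_gram[OF B skew_B]) (rule carr, use n in auto)
  qed
qed

text \<open>Moving one step along the chain on both sides and swapping twice gives
  \<open>v\<^sub>i \<bullet> A v\<^sub>j = v\<^sub>i\<^sub>+\<^sub>1 \<bullet> A v\<^sub>j\<^sub>-\<^sub>1\<close>; this leads to the middle, where the form alternates.\<close>

lemma chain_isotropic_A:
  assumes c: "chain A B n k v" and "i < k" "j < k"
  shows "v i \<bullet> (A *\<^sub>v v j) = 0"
proof -
  note v = chainD(1)[OF c] and step = chainD(2)[OF c]
  have "v i \<bullet> (A *\<^sub>v v (i + d)) = 0" if "i + d < k" for i d
    using that
  proof (induction d arbitrary: i rule: induct_nat_012)
    case 0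
    then show ?case using alternating(1)[OF v] by simp
  next
    case 1
    have "v i \<bullet> (A *\<^sub>v v (Suc i)) = v i \<bullet> (B *\<^sub>v v i)" using step[of i] 1 by simp
    then show ?case using alternating(2)[OF v] 1 by simp
  next
    case (ge2 d)
    have "v i \<bullet> (A *\<^sub>v v (i + Suc (Suc d))) = v i \<bullet> (B *\<^sub>v v (Suc (i + d)))"
      using step[of "Suc (i + d)"] ge2.prems by simp
    also have "\<dots> = - (v (Suc (i + d)) \<bullet> (A *\<^sub>v v (Suc i)))"
      using swap_B[OF v[of i] v[of "Suc (i + d)"]] step[of i] ge2.prems by simp
    also have "\<dots> = v (Suc i) \<bullet> (A *\<^sub>v v (Suc i + d))"
      using swap_A[OF v[of "Suc (i + d)"] v[of "Suc i"]] ge2.prems by simp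
    also have "\<dots> = 0" using ge2.IH(1)[of "Suc i"] ge2.prems by simp
    finally show ?case .
  qed
  from this[of i "j - i"] this[of j "i - j"] show ?thesis
    using assms(2,3) swap_A[OF v[of i] v[of j]] by (cases "i \<le> j") auto
qed

lemma chain_isotropic_B:
  assumes c: "chain A B n k v" and ij: "i < k" "j < k"
  shows "v i \<bullet> (B *\<^sub>v v j) = 0"
proof -
  note v = chainD(1)[OF c] and step = chainD(2)[OF c]
  have *: "v i \<bullet> (B *\<^sub>v v j) = 0" if "i < k" "Suc j < k" for i j
    using chain_isotropic_A[OF c that] step[OF that(2)] by simp
  consider "Suc j < k" | "Suc i < k" | "i = j" using ij by linarith
  then show ?thesis
  proof cases
    case 2
    then show ?thesis using *[OF ij(2) 2] swap_B[OF v[OF ij(1)] v[OF ij(2)]] by simp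
  qed (use * ij alternating(2)[OF v] in auto)
qed

end

section \<open>Dual chains and certificates\<close>

context skew_pair
begin

text \<open>The dual chain \<open>X\<close> is sought as the solution of the linear system consisting of the chain
  equations with index in \<open>C\<close> (index 0 stands for \<open>A X\<^sub>0 = 0\<close>), the equations \<open>p \<bullet> X\<^sub>j = 0\<close> for
  \<open>j \<in> D\<close>, and \<open>p \<bullet> X\<^sub>0 = 1\<close>. The unsolvability certificate consists of one vector \<open>u\<^sub>i\<close> for each chain
  equation and one scalar \<open>c\<^sub>j\<close> for each equation that involves \<open>p\<close>, and it satisfies the equations
  of a chain (with decreasing index) perturbed by multiples of \<open>p\<close>.\<close>

lemma chain_or_certificate:
  assumes p: "p \<in> carrier_vec n" and fin: "finite C" "finite D" and "0 \<notin> D"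
  shows "(\<exists>X. (\<forall>i. X i \<in> carrier_vec n) \<and>
        (\<forall>i\<in>C. A *\<^sub>v X i = (case i of 0 \<Rightarrow> 0\<^sub>v n | Suc j \<Rightarrow> B *\<^sub>v X j)) \<and>
        p \<bullet> X 0 = 1 \<and> (\<forall>j\<in>D. p \<bullet> X j = 0))
    \<or> (\<exists>u c. (\<forall>i. u i \<in> carrier_vec n) \<and> (\<forall>i. i \<notin> C \<longrightarrow> u i = 0\<^sub>v n) \<and>
        c 0 = 1 \<and> (\<forall>i. i \<noteq> 0 \<longrightarrow> i \<notin> D \<longrightarrow> c i = 0) \<and>
        (\<forall>i. A *\<^sub>v u i + c i \<cdot>\<^sub>v p = B *\<^sub>v u (Suc i)))"
proof -
  define W :: "(nat \<Rightarrow> 'a vec) set" where "W = {X. \<forall>i. X i \<in> carrier_vec n}"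
  define prev where "prev X i = (case i of 0 \<Rightarrow> 0\<^sub>v n | Suc j \<Rightarrow> B *\<^sub>v X j)" for X and i :: nat
  let ?I = "(C \<times> {0..<n}) <+> D"
  let ?\<phi> = "case_sum (\<lambda>(i, l) X. (A *\<^sub>v X i) $ l - prev X i $ l) (\<lambda>j X. p \<bullet> X j)"
  let ?\<psi> = "\<lambda>X. p \<bullet> X (0 :: nat)"
  let ?comb = "\<lambda>X c Y i. X i + c \<cdot>\<^sub>v Y i"
  have prev_carrier: "prev X i \<in> carrier_vec n" if "X \<in> W" for X i
    using that by (auto simp: prev_def W_def split: nat.split)
  have A_lin: "(A *\<^sub>v (x + c \<cdot>\<^sub>v y)) $ l = (A *\<^sub>v x) $ l + c * (A *\<^sub>v y) $ l"
    "(B *\<^sub>v (x + c \<cdot>\<^sub>v y)) $ l = (B *\<^sub>v x) $ l + c * (B *\<^sub>v y) $ l"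
    if "x \<in> carrier_vec n" "y \<in> carrier_vec n" "l < n" for x y c l
    using that A B by (auto simp: mult_add_distrib_mat_vec[where nc = n] mult_mat_vec[where nc = n]
      scalar_prod_add_distrib[where n = n])
  have p_lin: "\<forall>X\<in>W. \<forall>Y\<in>W. \<forall>c. p \<bullet> ?comb X c Y j = p \<bullet> X j + c * (p \<bullet> Y j)" for j
    using p by (auto simp: W_def scalar_prod_add_distrib[where n = n])
  have prev_lin: "prev (?comb X c Y) i $ l = prev X i $ l + c * prev Y i $ l"
    if "X \<in> W" "Y \<in> W" "l < n" for X Y c i l
    using that A_lin(2) by (auto simp: prev_def W_def split: nat.split)
  have "(\<exists>d. \<forall>X\<in>W. ?\<psi> X = (\<Sum>i\<in>?I. d i * ?\<phi> i X)) \<or> (\<exists>X\<in>W. (\<forall>i\<in>?I. ?\<phi> i X = 0) \<and> ?\<psi> X = 1)"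
  proof (rule functional_span_or_separated[where comb = ?comb])
    show "finite ?I" using fin by simp
    show "\<And>X c Y. X \<in> W \<Longrightarrow> Y \<in> W \<Longrightarrow> ?comb X c Y \<in> W" by (simp add: W_def)
    show "\<forall>X\<in>W. \<forall>Y\<in>W. \<forall>c. ?\<psi> (?comb X c Y) = ?\<psi> X + c * ?\<psi> Y" by (rule p_lin)
    show "\<forall>i\<in>?I. \<forall>X\<in>W. \<forall>Y\<in>W. \<forall>c. ?\<phi> i (?comb X c Y) = ?\<phi> i X + c * ?\<phi> i Y"
    proof (intro ballI allI)
      fix i X Y c assume i: "i \<in> ?I" and XY: "X \<in> W" "Y \<in> W"
      show "?\<phi> i (?comb X c Y) = ?\<phi> i X + c * ?\<phi> i Y"
      proof (cases i)
        case (Inl il)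
        then obtain j l where il: "i = Inl (j, l)" "l < n" using i by (cases il) auto
        then have "(A *\<^sub>v (X j + c \<cdot>\<^sub>v Y j)) $ l = (A *\<^sub>v X j) $ l + c * (A *\<^sub>v Y j) $ l"
          using XY by (intro A_lin) (auto simp: W_def)
        then show ?thesis using prev_lin[OF XY il(2)] il by (simp add: algebra_simps)
      next
        case (Inr j)
        then show ?thesis using p_lin[of j] XY by simp
      qed
    qed
  qed
  then show ?thesis
  proof (elim disjE exE bexE)
    fix X assume X: "X \<in> W" "(\<forall>i\<in>?I. ?\<phi> i X = 0) \<and> ?\<psi> X = 1"
    have "A *\<^sub>v X i = prev X i" if "i \<in> C" for i
    proof (intro eq_vecI)
      fix l assume "l < dim_vec (prev X i)"
      then have "l < n" using prev_carrier[OF X(1), of i] by simp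
      with that have "Inl (i, l) \<in> ?I" by auto
      then have "?\<phi> (Inl (i, l)) X = 0" using X(2) by blast
      then show "(A *\<^sub>v X i) $ l = prev X i $ l" by simp
    qed (use A prev_carrier[OF X(1), of i] in auto)
    moreover have "p \<bullet> X j = 0" if "j \<in> D" for j
    proof -
      have "?\<phi> (Inr j) X = 0" using X(2) that by blast
      then show ?thesis by simp
    qed
    ultimately show ?thesis using X unfolding W_def prev_def by blast
  next
    fix d assume d: "\<forall>X\<in>W. ?\<psi> X = (\<Sum>i\<in>?I. d i * ?\<phi> i X)"
    define u where "u i = (if i \<in> C then vec n (\<lambda>l. d (Inl (i, l))) else 0\<^sub>v n)" for i
    define c where "c i = (if i = 0 then 1 else if i \<in> D then - d (Inr i) else 0)" for i
    have u: "u i \<in> carrier_vec n" for i by (simp add: u_def)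
    have eq: "c i * (p \<bullet> x) = u i \<bullet> (A *\<^sub>v x) - u (Suc i) \<bullet> (B *\<^sub>v x)"
      if x: "x \<in> carrier_vec n" for i x
    proof -
      \<comment> \<open>Evaluate the linear relation at the sequence whose only nonzero term is \<open>x\<close>, at index \<open>i\<close>.\<close>
      define X where "X j = (if j = i then x else 0\<^sub>v n)" for j
      have X: "X \<in> W" using x by (simp add: W_def X_def)
      have summand: "(\<Sum>l\<in>{0..<n}. d (Inl (j, l)) * ((A *\<^sub>v X j) $ l - prev X j $ l)) =
        (if j = i then u i \<bullet> (A *\<^sub>v x) else 0) - (if j = Suc i then u (Suc i) \<bullet> (B *\<^sub>v x) else 0)"
        if "j \<in> C" for j
      proof -
        have "(\<Sum>l\<in>{0..<n}. d (Inl (j, l)) * ((A *\<^sub>v X j) $ l - prev X j $ l)) = u j \<bullet> (A *\<^sub>v X j - prev X j)"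
          unfolding scalar_prod_def using that prev_carrier[OF X, of j] A
          by (intro sum.cong) (auto simp: u_def)
        also have "\<dots> = u j \<bullet> (A *\<^sub>v X j) - u j \<bullet> prev X j"
          using u prev_carrier[OF X] X by (intro scalar_prod_minus_distrib[where n = n]) (auto simp: W_def)
        also have "u j \<bullet> (A *\<^sub>v X j) = (if j = i then u i \<bullet> (A *\<^sub>v x) else 0)"
          using u by (simp add: X_def)
        also have "u j \<bullet> prev X j = (if j = Suc i then u (Suc i) \<bullet> (B *\<^sub>v x) else 0)"
          using u by (auto simp: prev_def X_def split: nat.split)
        finally show ?thesis .
      qed
      have "?\<psi> X = (\<Sum>i\<in>?I. d i * ?\<phi> i X)" using d X by blast
      also have "\<dots> = (\<Sum>j\<in>C. \<Sum>l\<in>{0..<n}. d (Inl (j, l)) * ((A *\<^sub>v X j) $ l - prev X j $ l)) +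
          (\<Sum>j\<in>D. d (Inr j) * (p \<bullet> X j))"
        using fin by (simp add: sum.Plus sum.cartesian_product case_prod_unfold)
      also have "(\<Sum>j\<in>C. \<Sum>l\<in>{0..<n}. d (Inl (j, l)) * ((A *\<^sub>v X j) $ l - prev X j $ l)) =
          (\<Sum>j\<in>C. (if j = i then u i \<bullet> (A *\<^sub>v x) else 0) -
            (if j = Suc i then u (Suc i) \<bullet> (B *\<^sub>v x) else 0))"
        using summand by (intro sum.cong) auto
      also have "\<dots> = u i \<bullet> (A *\<^sub>v x) - u (Suc i) \<bullet> (B *\<^sub>v x)"
        using fin x by (simp add: sum_subtractf u_def)
      also have "(\<Sum>j\<in>D. d (Inr j) * (p \<bullet> X j)) = (\<Sum>j\<in>D. if j = i then d (Inr i) * (p \<bullet> x) else 0)"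
        using p by (intro sum.cong) (auto simp: X_def)
      finally show ?thesis
        using fin p \<open>0 \<notin> D\<close> by (auto simp: X_def c_def algebra_simps split: if_splits)
    qed
    have "A *\<^sub>v u i + c i \<cdot>\<^sub>v p = B *\<^sub>v u (Suc i)" for i
    proof (intro eq_vecI)
      fix l assume "l < dim_vec (B *\<^sub>v u (Suc i))"
      then have l: "l < n" using B by simp
      let ?e = "unit_vec n l :: 'a vec"
      have e: "?e \<in> carrier_vec n" by simp
      have "c i * (p \<bullet> ?e) = - (?e \<bullet> (A *\<^sub>v u i)) + ?e \<bullet> (B *\<^sub>v u (Suc i))"
        using eq[OF e, of i] swap_A[OF u e] swap_B[OF u e] by simp
      then have "c i * p $ l = - (A *\<^sub>v u i) $ l + (B *\<^sub>v u (Suc i)) $ l"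
        using l p u by (simp only: scalar_prod_left_unit[OF mult_carrier(1)[OF u]]
          scalar_prod_left_unit[OF mult_carrier(2)[OF u]] scalar_prod_right_unit)
      then show "(A *\<^sub>v u i + c i \<cdot>\<^sub>v p) $ l = (B *\<^sub>v u (Suc i)) $ l"
        using l p by simp
    qed (use B p in auto)
    moreover have "\<forall>i. i \<notin> C \<longrightarrow> u i = 0\<^sub>v n" "c 0 = 1" "\<forall>i. i \<noteq> 0 \<longrightarrow> i \<notin> D \<longrightarrow> c i = 0"
      by (auto simp: u_def c_def)
    ultimately show ?thesis using u by blast
  qed
qed

lemma closed_chain_of_long_chain:
  assumes c: "chain A B n (Suc n) v" and v0: "A *\<^sub>v v 0 = 0\<^sub>v n" "v 0 \<noteq> 0\<^sub>v n"
  shows "\<exists>k w. closed_chain A B n k w"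
proof -
  note v = chainD(1)[OF c] and step = chainD(2)[OF c]
  let ?M = "mat n (Suc n) (\<lambda>(r, i). v i $ r)"
  obtain x where x: "x \<in> carrier_vec (Suc n)" "x \<noteq> 0\<^sub>v (Suc n)" "?M *\<^sub>v x = 0\<^sub>v n"
    using exists_kernel_vec[of ?M n "Suc n"] by auto
  from x(1,2) have ex: "\<exists>i. i < Suc n \<and> x $ i \<noteq> 0"
    by (metis carrier_vecD eq_vecI index_zero_vec(1) index_zero_vec(2))
  define l where "l = (GREATEST i. i < Suc n \<and> x $ i \<noteq> 0)"
  have l: "l < Suc n" "x $ l \<noteq> 0"
    using GreatestI_ex_nat[OF ex, of n] unfolding l_def by auto
  have max: "x $ i = 0" if "l < i" "i < Suc n" for i
    using Greatest_le_nat[of "\<lambda>i. i < Suc n \<and> x $ i \<noteq> 0" i n] that unfolding l_def by force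
  \<comment> \<open>For a linear relation \<open>\<Sum>i\<le>l. x\<^sub>i v\<^sub>i = 0\<close> with \<open>x\<^sub>l \<noteq> 0\<close>, the combinations
    \<open>w\<^sub>j = \<Sum>i\<le>l. x\<^sub>i v\<^sub>i\<^sub>+\<^sub>j\<^sub>-\<^sub>l\<close>, with zero in place of terms of negative index, form a closed chain for
    \<open>j < l\<close>: they start with \<open>w\<^sub>0 = x\<^sub>l v\<^sub>0\<close>, and \<open>w\<^sub>l = 0\<close>.\<close>
  let ?V = "\<lambda>j. mat n (Suc n) (\<lambda>(r, i). if l \<le> i + j \<and> i \<le> l then v (i + j - l) $ r else 0)"
  define w where "w j = ?V j *\<^sub>v x" for j
  have w: "w j \<in> carrier_vec n" for j using x(1) unfolding w_def by (intro mult_mat_vec_carrier) auto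
  have col: "col (?V j) i = (if l \<le> i + j \<and> i \<le> l then v (i + j - l) else 0\<^sub>v n)"
    if "i < Suc n" "j \<le> l" for i j
  proof (cases "i \<le> l")
    case True
    then have "v (i + j - l) \<in> carrier_vec n" using that l(1) by (intro v) linarith
    then have "dim_vec (v (i + j - l)) = n" by simp
    then show ?thesis using that by (intro eq_vecI) auto
  qed (use that in \<open>auto intro!: eq_vecI\<close>)
  have "A *\<^sub>v w (Suc j) = B *\<^sub>v w j" if "j < l" for j
  proof -
    have "A * ?V (Suc j) = B * ?V j"
    proof (rule mat_col_eqI)
      fix i assume "i < dim_col (B * ?V j)"
      then have i: "i < Suc n" by simp
      have "A *\<^sub>v col (?V (Suc j)) i = B *\<^sub>v col (?V j) i"
        using col[OF i, of j] col[OF i, of "Suc j"] step[of "i + j - l"] v0 l(1) that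
        by (auto simp: Suc_diff_le not_less_eq_eq le_Suc_eq)
      moreover have "col (A * ?V (Suc j)) i = A *\<^sub>v col (?V (Suc j)) i"
        using A i by (intro eq_vecI) auto
      moreover have "col (B * ?V j) i = B *\<^sub>v col (?V j) i"
        using B i by (intro eq_vecI) auto
      ultimately show "col (A * ?V (Suc j)) i = col (B * ?V j) i" by simp
    qed (use A B in auto)
    moreover have "A *\<^sub>v w (Suc j) = (A * ?V (Suc j)) *\<^sub>v x" "B *\<^sub>v w j = (B * ?V j) *\<^sub>v x"
      unfolding w_def using A B x(1) by (simp_all add: assoc_mult_mat_vec[where n\<^sub>2 = n and n\<^sub>3 = "Suc n"])
    ultimately show ?thesis by simp
  qed
  then have ch: "chain A B n l w" unfolding chain_def using w by auto
  have wl: "w l = 0\<^sub>v n"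
  proof (intro eq_vecI)
    fix r assume "r < dim_vec (0\<^sub>v n :: 'a vec)"
    then have r: "r < n" by simp
    have "w l $ r = (?M *\<^sub>v x) $ r"
      using r x(1) max by (auto simp: w_def scalar_prod_def intro!: sum.cong)
    then show "w l $ r = 0\<^sub>v n $ r" using x(3) by simp
  qed (use w in auto)
  have w0: "w 0 = x $ l \<cdot>\<^sub>v v 0"
  proof (intro eq_vecI)
    fix r assume "r < dim_vec (x $ l \<cdot>\<^sub>v v 0)"
    then have r: "r < n" using v[of 0] by simp
    have "w 0 $ r = (\<Sum>i\<in>{0..<Suc n}. (if l \<le> i \<and> i \<le> l then v (i - l) $ r else 0) * x $ i)"
      using r x(1) by (simp only: w_def) (auto simp: scalar_prod_def simp del: sum.op_ivl_Suc intro!: sum.cong)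
    also have "\<dots> = (\<Sum>i\<in>{0..<Suc n}. if i = l then x $ l * v 0 $ r else 0)"
      by (intro sum.cong) auto
    finally have "w 0 $ r = (\<Sum>i\<in>{0..<Suc n}. if i = l then x $ l * v 0 $ r else 0)" .
    then show "w 0 $ r = (x $ l \<cdot>\<^sub>v v 0) $ r" using r l v[of 0] by simp
  qed (use w v[of 0] in auto)
  have "w 0 \<noteq> 0\<^sub>v n"
  proof
    assume "w 0 = 0\<^sub>v n"
    have "v 0 $ r = 0" if "r < n" for r
    proof -
      have "(x $ l \<cdot>\<^sub>v v 0) $ r = 0" using \<open>w 0 = 0\<^sub>v n\<close> w0 that by simp
      then show ?thesis using that v[of 0] l by simp
    qed
    then have "v 0 = 0\<^sub>v n" using v[of 0] by (intro eq_vecI) auto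
    then show False using v0 by simp
  qed
  then have "0 < l" using wl by (cases l) auto
  have "A *\<^sub>v w 0 = 0\<^sub>v n"
    unfolding w0 using A v[of 0] v0 by (auto simp: mult_mat_vec[where nr = n and nc = n])
  moreover have "B *\<^sub>v w (l - 1) = 0\<^sub>v n"
    using \<open>\<And>j. j < l \<Longrightarrow> A *\<^sub>v w (Suc j) = B *\<^sub>v w j\<close>[of "l - 1"] \<open>0 < l\<close> wl by simp
  ultimately show ?thesis
    using ch \<open>0 < l\<close> \<open>w 0 \<noteq> 0\<^sub>v n\<close> unfolding closed_chain_def by blast
qed

end

section \<open>Splitting off isotropic summands\<close>

lemma gram_skew_block:
  assumes A: "A \<in> carrier_mat n n" "A\<^sup>T = - A"
    and carr: "\<And>i. i < r \<Longrightarrow> s i \<in> carrier_vec n" "\<And>j. j < c \<Longrightarrow> t j \<in> carrier_vec n"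
    and iso: "\<And>i j. i < r \<Longrightarrow> j < r \<Longrightarrow> s i \<bullet> (A *\<^sub>v s j) = 0"
      "\<And>i j. i < c \<Longrightarrow> j < c \<Longrightarrow> t i \<bullet> (A *\<^sub>v t j) = 0"
  shows "gram (r + c) (\<lambda>i. if i < r then s i else t (i - r)) A =
    skew_block (mat r c (\<lambda>(i, j). s i \<bullet> (A *\<^sub>v t j)))" (is "?G = ?S")
proof (intro eq_matI)
  fix i j assume "i < dim_row ?S" "j < dim_col ?S"
  then have ij: "i < r + c" "j < r + c" by (auto simp: skew_block_def)
  have "t (i - r) \<bullet> (A *\<^sub>v s j) = - (s j \<bullet> (A *\<^sub>v t (i - r)))" if "\<not> i < r" "j < r"
    using that ij by (intro skew_form_swap[OF A] carr) auto
  then show "?G $$ (i, j) = ?S $$ (i, j)"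
    using ij iso by (auto simp: gram_def skew_block_def)
qed (auto simp: gram_def skew_block_def)

context skew_pair
begin

text \<open>The form in which \<open>split_summand\<close> is applied: the subspace is spanned by two families \<open>s\<close> and
  \<open>t\<close>, each isotropic for both forms, so that its Gram matrices are of the shape of the canonical
  summands. The coordinate functionals are \<open>\<sigma>\<close> and \<open>\<tau>\<close>.\<close>

lemma split_isotropic_summand:
  assumes s: "\<And>i. i < r \<Longrightarrow> s i \<in> carrier_vec n" "\<And>i. i < r \<Longrightarrow> \<sigma> i \<in> carrier_vec n"
    and t: "\<And>j. j < c \<Longrightarrow> t j \<in> carrier_vec n" "\<And>j. j < c \<Longrightarrow> \<tau> j \<in> carrier_vec n"
    and dual: "\<And>i j. i < r \<Longrightarrow> j < r \<Longrightarrow> \<sigma> i \<bullet> s j = (if i = j then 1 else 0)"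
      "\<And>i j. i < r \<Longrightarrow> j < c \<Longrightarrow> \<sigma> i \<bullet> t j = 0"
      "\<And>i j. i < c \<Longrightarrow> j < r \<Longrightarrow> \<tau> i \<bullet> s j = 0"
      "\<And>i j. i < c \<Longrightarrow> j < c \<Longrightarrow> \<tau> i \<bullet> t j = (if i = j then 1 else 0)"
    and iso_s: "\<And>i j. i < r \<Longrightarrow> j < r \<Longrightarrow> s i \<bullet> (A *\<^sub>v s j) = 0 \<and> s i \<bullet> (B *\<^sub>v s j) = 0"
    and iso_t: "\<And>i j. i < c \<Longrightarrow> j < c \<Longrightarrow> t i \<bullet> (A *\<^sub>v t j) = 0 \<and> t i \<bullet> (B *\<^sub>v t j) = 0"
    and ann: "\<And>x. x \<in> carrier_vec n \<Longrightarrow> \<forall>i<r. \<sigma> i \<bullet> x = 0 \<Longrightarrow> \<forall>j<c. \<tau> j \<bullet> x = 0 \<Longrightarrow>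
      (\<forall>i<r. s i \<bullet> (A *\<^sub>v x) = 0 \<and> s i \<bullet> (B *\<^sub>v x) = 0) \<and>
      (\<forall>j<c. t j \<bullet> (A *\<^sub>v x) = 0 \<and> t j \<bullet> (B *\<^sub>v x) = 0)"
  shows "r + c \<le> n \<and> (\<exists>P\<in>pair_carrier (n - (r + c)). skew_symmetric_mat (fst P) \<and> skew_symmetric_mat (snd P) \<and>
    congruent_pairs (A, B) (pair_dsum P
      (skew_block (mat r c (\<lambda>(i, j). s i \<bullet> (A *\<^sub>v t j))), skew_block (mat r c (\<lambda>(i, j). s i \<bullet> (B *\<^sub>v t j))))))"
proof -
  let ?u = "\<lambda>i. if i < r then s i else t (i - r)"
  let ?\<phi> = "\<lambda>i. if i < r then \<sigma> i else \<tau> (i - r)"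
  have d: "dual_system n (r + c) ?u ?\<phi>"
    unfolding dual_system_def using s t dual by auto
  have "\<exists>P\<in>pair_carrier (n - (r + c)). skew_symmetric_mat (fst P) \<and> skew_symmetric_mat (snd P) \<and>
    congruent_pairs (A, B) (pair_dsum P (gram (r + c) ?u A, gram (r + c) ?u B))"
  proof (rule split_summand[OF d])
    fix x i
    assume x: "x \<in> carrier_vec n" and "\<forall>j<r + c. ?\<phi> j \<bullet> x = 0" and i: "i < r + c"
    then have z: "?\<phi> j \<bullet> x = 0" if "j < r + c" for j using that by blast
    have "\<sigma> j \<bullet> x = 0" if "j < r" for j using z[of j] that by simp
    moreover have "\<tau> j \<bullet> x = 0" if "j < c" for j using z[of "r + j"] that by simp
    ultimately have "(\<forall>i<r. s i \<bullet> (A *\<^sub>v x) = 0 \<and> s i \<bullet> (B *\<^sub>v x) = 0) \<and>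
      (\<forall>j<c. t j \<bullet> (A *\<^sub>v x) = 0 \<and> t j \<bullet> (B *\<^sub>v x) = 0)"
      using ann[OF x] by blast
    then show "?u i \<bullet> (A *\<^sub>v x) = 0 \<and> ?u i \<bullet> (B *\<^sub>v x) = 0" using i by auto
  qed
  moreover have "gram (r + c) ?u A = skew_block (mat r c (\<lambda>(i, j). s i \<bullet> (A *\<^sub>v t j)))"
    using iso_s iso_t by (intro gram_skew_block[OF A skew_A s(1) t(1)]) auto
  moreover have "gram (r + c) ?u B = skew_block (mat r c (\<lambda>(i, j). s i \<bullet> (B *\<^sub>v t j)))"
    using iso_s iso_t by (intro gram_skew_block[OF B skew_B s(1) t(1)]) auto
  ultimately show ?thesis using dual_system_le[OF d] by simp
qed

end

section \<open>Summands from closed chains\<close>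

context skew_pair
begin

text \<open>For \<open>k = 0\<close> the dual chain is empty; this is the case of \<open>\<L>\<^sub>1\<close>.\<close>

lemma minimal_closed_chain_dual:
  assumes cc: "closed_chain A B n (Suc k) v"
    and min: "\<And>j w. j < Suc k \<Longrightarrow> \<not> closed_chain A B n j w"
  shows "\<exists>e. chain A B n k e \<and> (0 < k \<longrightarrow> e 0 \<bullet> (A *\<^sub>v v k) = 1)" and "v k \<noteq> 0\<^sub>v n"
proof -
  have c: "chain A B n (Suc k) v" and ends: "A *\<^sub>v v 0 = 0\<^sub>v n" "B *\<^sub>v v k = 0\<^sub>v n"
    and nz: "\<exists>i<Suc k. v i \<noteq> 0\<^sub>v n"
    using cc unfolding closed_chain_def by auto
  note v = chainD(1)[OF c] and step = chainD(2)[OF c]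
  show vk: "v k \<noteq> 0\<^sub>v n"
  proof
    assume vk: "v k = 0\<^sub>v n"
    with nz have nz': "\<exists>i<k. v i \<noteq> 0\<^sub>v n" by (metis less_Suc_eq)
    then have "0 < k" by auto
    moreover have "chain A B n k v" using c unfolding chain_def by simp
    moreover have "B *\<^sub>v v (k - 1) = 0\<^sub>v n" using step[of "k - 1"] \<open>0 < k\<close> vk by simp
    ultimately have "closed_chain A B n k v" unfolding closed_chain_def using ends nz' by simp
    then show False using min by blast
  qed
  show "\<exists>e. chain A B n k e \<and> (0 < k \<longrightarrow> e 0 \<bullet> (A *\<^sub>v v k) = 1)"
  proof (cases "k = 0")
    case True
    then show ?thesis by (auto simp: chain_def)
  next
    case False
    have p: "A *\<^sub>v v k \<in> carrier_vec n" using v by simp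
    have "0 \<notin> ({} :: nat set)" by simp
    from chain_or_certificate[OF p finite_atLeastLessThan[of 1 k] finite.emptyI this] show ?thesis
    proof (elim disjE exE conjE)
      fix e
      assume e: "\<forall>i. e i \<in> carrier_vec n" "(A *\<^sub>v v k) \<bullet> e 0 = 1"
        and e_step: "\<forall>i\<in>{1..<k}. A *\<^sub>v e i = (case i of 0 \<Rightarrow> 0\<^sub>v n | Suc j \<Rightarrow> B *\<^sub>v e j)"
      have "A *\<^sub>v e (Suc i) = B *\<^sub>v e i" if "Suc i < k" for i
        using bspec[OF e_step, of "Suc i"] that by simp
      then have "chain A B n k e" unfolding chain_def using e(1) by blast
      moreover have "e 0 \<bullet> (A *\<^sub>v v k) = 1"
        using e p comm_scalar_prod[of "e 0" n "A *\<^sub>v v k"] by simp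
      ultimately show ?thesis by blast
    next
      fix u c
      assume u: "\<forall>i. u i \<in> carrier_vec n" and off: "\<forall>i. i \<notin> {1..<k} \<longrightarrow> u i = 0\<^sub>v n"
        and c0: "c 0 = 1" "\<forall>i. i \<noteq> 0 \<longrightarrow> i \<notin> {} \<longrightarrow> c i = 0"
        and cert: "\<forall>i. A *\<^sub>v u i + c i \<cdot>\<^sub>v (A *\<^sub>v v k) = B *\<^sub>v u (Suc i)"
      have u0: "u 0 = 0\<^sub>v n" "u k = 0\<^sub>v n" using off by auto
      have first: "A *\<^sub>v v k = B *\<^sub>v u 1" using cert[rule_format, of 0] u0 c0 v[of k] by simp
      have next': "A *\<^sub>v u (Suc i) = B *\<^sub>v u (Suc (Suc i))" for i
      proof -
        have "0 \<cdot>\<^sub>v (A *\<^sub>v v k) = 0\<^sub>v n" using A by (intro eq_vecI) auto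
        then show ?thesis using cert[rule_format, of "Suc i"] c0 u by simp
      qed
      \<comment> \<open>The certificate, read backwards, is the beginning of a shorter closed chain ending in \<open>v k\<close>.\<close>
      define w where "w j = (if j < k - 1 then u (k - 1 - j) else v k)" for j
      have "closed_chain A B n k w"
        unfolding closed_chain_def chain_def
      proof (intro conjI allI impI)
        show "w i \<in> carrier_vec n" for i using u v by (simp add: w_def)
        show "A *\<^sub>v w (Suc j) = B *\<^sub>v w j" if "Suc j < k" for j
        proof (cases "Suc j < k - 1")
          case True
          then obtain d where "k = Suc (Suc (Suc (j + d)))"
            by (metis less_iff_Suc_add Suc_diff_1 False gr0I add_Suc)
          then show ?thesis using next'[of d] by (simp add: w_def)
        next
          case False
          then have "k = Suc (Suc j)" using that by simp
          then show ?thesis using first by (simp add: w_def)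
        qed
        show "A *\<^sub>v w 0 = 0\<^sub>v n"
        proof (cases "k = 1")
          case True
          then show ?thesis using first u0 by (simp add: w_def)
        next
          case False
          then obtain d where "k = Suc (Suc d)" using \<open>k \<noteq> 0\<close> by (cases k rule: nat.exhaust; cases "k - 1") auto
          then show ?thesis using next'[of d] u0 by (simp add: w_def)
        qed
        show "0 < k" using False by simp
        show "B *\<^sub>v w (k - 1) = 0\<^sub>v n" using ends by (simp add: w_def)
        show "\<exists>i<k. w i \<noteq> 0\<^sub>v n" using vk False by (intro exI[of _ "k - 1"]) (simp add: w_def)
      qed
      then show ?thesis using min by blast
    qed
  qed
qed

lemma closed_chain_pairing:
  assumes cc: "closed_chain A B n (Suc k) v" and e: "chain A B n k e"
    and one: "0 < k \<Longrightarrow> e 0 \<bullet> (A *\<^sub>v v k) = 1" and ij: "i < k" "j \<le> k"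
  shows "e i \<bullet> (A *\<^sub>v v j) = (if i + j = k then 1 else 0)"
    and "e i \<bullet> (B *\<^sub>v v j) = (if Suc (i + j) = k then 1 else 0)"
proof -
  have c: "chain A B n (Suc k) v" and ends: "A *\<^sub>v v 0 = 0\<^sub>v n" "B *\<^sub>v v k = 0\<^sub>v n"
    using cc unfolding closed_chain_def by auto
  note v = chainD(1)[OF c] and step = chainD(2)[OF c]
  note ec = chainD(1)[OF e] and e_step = chainD(2)[OF e]
  have shift_v: "e i \<bullet> (B *\<^sub>v v j) = e i \<bullet> (A *\<^sub>v v (Suc j))" if "j < k" for i j
    using step[of j] that by simp
  have shift_e: "e (Suc i) \<bullet> (A *\<^sub>v v j) = e i \<bullet> (B *\<^sub>v v j)" if "Suc i < k" "j \<le> k" for i j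
    using that swap_A[OF ec[of "Suc i"] v[of j]] swap_B[OF ec[of i] v[of j]] e_step[of i] by simp
  have low: "e i \<bullet> (A *\<^sub>v v j) = 0" if "i + j < k" for i j
    using that
  proof (induction j arbitrary: i)
    case 0
    then show ?case using ends ec by simp
  next
    case (Suc j)
    then show ?case using shift_v[of j i] shift_e[of i j] by simp
  qed
  have high: "e i \<bullet> (A *\<^sub>v v j) = (if i + j = k then 1 else 0)" if "i < k" "j \<le> k" "k \<le> i + j" for i j
    using that
  proof (induction i arbitrary: j)
    case 0
    then show ?case using one by simp
  next
    case (Suc i)
    show ?case
    proof (cases "j = k")
      case True
      then show ?thesis using Suc.prems shift_e[of i j] ends ec[of i] by simp
    next
      case False
      then show ?thesis using Suc.prems shift_e[of i j] shift_v[of j i] Suc.IH[of "Suc j"] by simp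
    qed
  qed
  have A_pairing: "e i \<bullet> (A *\<^sub>v v j) = (if i + j = k then 1 else 0)" if "i < k" "j \<le> k" for i j
    using low[of i j] high[OF that] by (cases "i + j < k") auto
  from A_pairing[OF ij] show "e i \<bullet> (A *\<^sub>v v j) = (if i + j = k then 1 else 0)" .
  show "e i \<bullet> (B *\<^sub>v v j) = (if Suc (i + j) = k then 1 else 0)"
  proof (cases "j = k")
    case True
    then show ?thesis using ends ec[OF ij(1)] by simp
  next
    case False
    then show ?thesis using shift_v[of j i] A_pairing[of i "Suc j"] ij by simp
  qed
qed

lemma closed_chain_splits_L_pair:
  assumes "closed_chain A B n k0 v0"
  shows "\<exists>m P. 0 < m \<and> 2 * m - 1 \<le> n \<and> P \<in> pair_carrier (n - (2 * m - 1)) \<and>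
    skew_symmetric_mat (fst P) \<and> skew_symmetric_mat (snd P) \<and> congruent_pairs (A, B) (pair_dsum P (L_pair m))"
proof -
  define m where "m = (LEAST m. \<exists>v. closed_chain A B n m v)"
  have "\<exists>v. closed_chain A B n m v"
    unfolding m_def by (rule LeastI_ex) (use assms in blast)
  then obtain v where cc': "closed_chain A B n m v" by blast
  define k where "k = m - 1"
  have m: "m = Suc k" using cc' unfolding closed_chain_def k_def by simp
  note cc = cc'[unfolded m]
  have min: "\<not> closed_chain A B n j w" if "j < Suc k" for j w
    using not_less_Least[of j "\<lambda>m. \<exists>v. closed_chain A B n m v"] that m m_def by auto
  have c: "chain A B n (Suc k) v" and ends: "A *\<^sub>v v 0 = 0\<^sub>v n" "B *\<^sub>v v k = 0\<^sub>v n"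
    using cc unfolding closed_chain_def by auto
  note v = chainD(1)[OF c] and step = chainD(2)[OF c]
  from minimal_closed_chain_dual(1)[OF cc min] obtain e where e: "chain A B n k e"
    and one: "0 < k \<Longrightarrow> e 0 \<bullet> (A *\<^sub>v v k) = 1" by blast
  note ec = chainD(1)[OF e] and e_step = chainD(2)[OF e]
  note pair = closed_chain_pairing[OF cc e one]
  have vk: "v k \<noteq> 0\<^sub>v n" by (rule minimal_closed_chain_dual(2)[OF cc min])
  \<comment> \<open>The coordinate along the last basis vector is represented by \<open>- B (e (k - 1))\<close>, which does not exist
    for \<open>k = 0\<close>; there any vector that pairs to one with \<open>v 0\<close> will do.\<close>
  obtain q where q: "q \<in> carrier_vec n" "\<And>j. j \<le> k \<Longrightarrow> q \<bullet> v j = (if j = 0 then 1 else 0)"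
    "\<And>i. i < k \<Longrightarrow> q \<bullet> e i = 0" "0 < k \<Longrightarrow> q = - (B *\<^sub>v e (k - 1))"
  proof (cases "k = 0")
    case True
    have "\<exists>r<n. v 0 $ r \<noteq> 0"
    proof (rule ccontr)
      assume "\<not> ?thesis"
      then have "v k = 0\<^sub>v n" using v[of 0] True by (intro eq_vecI) auto
      then show False using vk by simp
    qed
    then obtain r where r: "r < n" "v 0 $ r \<noteq> 0" by blast
    show ?thesis
      by (rule that[of "(1 / v 0 $ r) \<cdot>\<^sub>v unit_vec n r"]) (use True r v[of 0] in auto)
  next
    case False
    have q: "(- (B *\<^sub>v e (k - 1))) \<bullet> x = e (k - 1) \<bullet> (B *\<^sub>v x)" if "x \<in> carrier_vec n" for x
    proof -
      have k: "k - 1 < k" using False by simp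
      have "(B *\<^sub>v e (k - 1)) \<bullet> x = x \<bullet> (B *\<^sub>v e (k - 1))"
        using that ec[OF k] by (intro comm_scalar_prod[of _ n]) auto
      then show ?thesis using swap_B[OF that ec[OF k]] that B by simp
    qed
    show ?thesis
    proof (rule that[of "- (B *\<^sub>v e (k - 1))"])
      show "- (B *\<^sub>v e (k - 1)) \<in> carrier_vec n" using ec[of "k - 1"] False by simp
      show "(- (B *\<^sub>v e (k - 1))) \<bullet> v j = (if j = 0 then 1 else 0)" if "j \<le> k" for j
        using q[OF v[of j]] pair(2)[of "k - 1" j] that False by simp
      show "(- (B *\<^sub>v e (k - 1))) \<bullet> e i = 0" if "i < k" for i
        using q[OF ec[OF that]] chain_isotropic_B[OF e, of "k - 1" i] that by simp
    qed simp
  qed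
  define f where "f j = v (k - j)" for j
  define \<sigma> where "\<sigma> i = A *\<^sub>v f i" for i
  define \<tau> where "\<tau> j = (if j = k then q else - (A *\<^sub>v e j))" for j
  have f: "f j \<in> carrier_vec n" for j using v by (simp add: f_def)
  have \<sigma>: "\<sigma> i \<bullet> x = x \<bullet> (A *\<^sub>v f i)" if "x \<in> carrier_vec n" for i x
    unfolding \<sigma>_def using that f by (intro comm_scalar_prod[of _ n]) auto
  have \<tau>: "\<tau> j \<bullet> x = e j \<bullet> (A *\<^sub>v x)" if "x \<in> carrier_vec n" "j < k" for j x
  proof -
    have "(A *\<^sub>v e j) \<bullet> x = x \<bullet> (A *\<^sub>v e j)"
      using that ec by (intro comm_scalar_prod[of _ n]) auto
    then show ?thesis using swap_A[OF that(1) ec[OF that(2)]] that A by (simp add: \<tau>_def)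
  qed
  have "k + Suc k \<le> n \<and> (\<exists>P\<in>pair_carrier (n - (k + Suc k)). skew_symmetric_mat (fst P) \<and> skew_symmetric_mat (snd P) \<and>
    congruent_pairs (A, B) (pair_dsum P
      (skew_block (mat k (Suc k) (\<lambda>(i, j). e i \<bullet> (A *\<^sub>v f j))), skew_block (mat k (Suc k) (\<lambda>(i, j). e i \<bullet> (B *\<^sub>v f j))))))"
  proof (rule split_isotropic_summand[where \<sigma> = \<sigma> and \<tau> = \<tau>])
    show "e i \<in> carrier_vec n" if "i < k" for i using ec that by simp
    show "\<sigma> i \<in> carrier_vec n" if "i < k" for i using f by (simp add: \<sigma>_def)
    show "f j \<in> carrier_vec n" for j by (rule f)
    show "\<tau> j \<in> carrier_vec n" if "j < Suc k" for j using ec q(1) that by (auto simp: \<tau>_def)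
    show "\<sigma> i \<bullet> e j = (if i = j then 1 else 0)" if "i < k" "j < k" for i j
      using \<sigma>[OF ec[OF that(2)]] pair(1)[of j "k - i"] that by (auto simp: f_def)
    show "\<sigma> i \<bullet> f j = 0" for i j
      using \<sigma>[OF f] chain_isotropic_A[OF c, of "k - j" "k - i"] by (simp add: f_def)
    show "\<tau> i \<bullet> e j = 0" if "i < Suc k" "j < k" for i j
      using \<tau>[OF ec[OF that(2)], of i] q(3)[OF that(2)] chain_isotropic_A[OF e, of i j] that
      by (cases "i = k") (auto simp: \<tau>_def)
    show "\<tau> i \<bullet> f j = (if i = j then 1 else 0)" if "i < Suc k" "j < Suc k" for i j
      using \<tau>[OF f, of i j] q(2)[of "k - j"] pair(1)[of i "k - j"] that
      by (cases "i = k") (auto simp: \<tau>_def f_def)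
    show "e i \<bullet> (A *\<^sub>v e j) = 0 \<and> e i \<bullet> (B *\<^sub>v e j) = 0" if "i < k" "j < k" for i j
      using chain_isotropic_A[OF e that] chain_isotropic_B[OF e that] by simp
    show "f i \<bullet> (A *\<^sub>v f j) = 0 \<and> f i \<bullet> (B *\<^sub>v f j) = 0" for i j
      using chain_isotropic_A[OF c, of "k - i" "k - j"] chain_isotropic_B[OF c, of "k - i" "k - j"]
      by (simp add: f_def)
    fix x assume x: "x \<in> carrier_vec n" and zs: "\<forall>i<k. \<sigma> i \<bullet> x = 0" and zt: "\<forall>j<Suc k. \<tau> j \<bullet> x = 0"
    have xv: "x \<bullet> (A *\<^sub>v v j) = 0" if "j \<le> k" for j
    proof (cases "j = 0")
      case False
      then have "k - j < k" "k - (k - j) = j" using that by auto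
      then show ?thesis using zs \<sigma>[OF x, of "k - j"] by (simp add: f_def)
    qed (use ends x in simp)
    have xv': "x \<bullet> (B *\<^sub>v v j) = 0" if "j \<le> k" for j
      using xv[of "Suc j"] step[of j] ends x that by (cases "j = k") auto
    have ex: "e i \<bullet> (A *\<^sub>v x) = 0" if "i < k" for i
      using zt \<tau>[OF x that] that by auto
    have ex': "e i \<bullet> (B *\<^sub>v x) = 0" if "i < k" for i
    proof (cases "Suc i = k")
      case True
      then have "q = - (B *\<^sub>v e i)" using q(4) by auto
      moreover have "q \<bullet> x = 0" using zt by (auto simp: \<tau>_def)
      ultimately have "(B *\<^sub>v e i) \<bullet> x = 0" using x B by simp
      then have "x \<bullet> (B *\<^sub>v e i) = 0"
        using comm_scalar_prod[of x n "B *\<^sub>v e i"] x ec[OF that] by simp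
      then show ?thesis using swap_B[OF x ec[OF that]] by simp
    next
      case False
      then have "Suc i < k" using that by simp
      then have "x \<bullet> (B *\<^sub>v e i) = 0"
        using ex[of "Suc i"] e_step[of i] swap_A[OF x ec[of "Suc i"]] by simp
      then show ?thesis using swap_B[OF x ec[OF that]] by simp
    qed
    show "(\<forall>i<k. e i \<bullet> (A *\<^sub>v x) = 0 \<and> e i \<bullet> (B *\<^sub>v x) = 0) \<and>
      (\<forall>j<Suc k. f j \<bullet> (A *\<^sub>v x) = 0 \<and> f j \<bullet> (B *\<^sub>v x) = 0)"
      using ex ex' xv xv' swap_A[OF f x] swap_B[OF f x] by (simp add: f_def)
  qed
  moreover have "mat k (Suc k) (\<lambda>(i, j). e i \<bullet> (A *\<^sub>v f j)) = L_mat (Suc k)"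
    unfolding L_mat_def using pair(1) by (intro eq_matI) (auto simp: f_def)
  moreover have "mat k (Suc k) (\<lambda>(i, j). e i \<bullet> (B *\<^sub>v f j)) = R_mat (Suc k)"
    unfolding R_mat_def using pair(2) by (intro eq_matI) (auto simp: f_def)
  ultimately have "k + Suc k \<le> n \<and> (\<exists>P\<in>pair_carrier (n - (k + Suc k)). skew_symmetric_mat (fst P) \<and>
    skew_symmetric_mat (snd P) \<and> congruent_pairs (A, B) (pair_dsum P (L_pair (Suc k))))"
    by (simp add: L_pair_def)
  moreover have "k + Suc k = 2 * Suc k - 1" by simp
  ultimately show ?thesis by (metis zero_less_Suc)
qed

end

section \<open>Summands from open chains\<close>

context skew_pair
begin

text \<open>The equations \<open>v\<^sub>k\<^sub>-\<^sub>1 \<bullet> B g\<^sub>j = 0\<close> for \<open>j > 0\<close> are included in the linear system, so that the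
  pairing of the two chains is already in normal form.\<close>

lemma maximal_chain_dual:
  assumes c: "chain A B n k v" and v0: "A *\<^sub>v v 0 = 0\<^sub>v n" "v 0 \<noteq> 0\<^sub>v n" and "0 < k"
    and max: "\<nexists>w. chain A B n (Suc k) w \<and> A *\<^sub>v w 0 = 0\<^sub>v n \<and> w 0 \<noteq> 0\<^sub>v n"
  shows "\<exists>g. chain A B n k g \<and> A *\<^sub>v g 0 = 0\<^sub>v n \<and>
    (\<forall>j<k. v (k - 1) \<bullet> (B *\<^sub>v g j) = (if j = 0 then 1 else 0))"
proof -
  note v = chainD(1)[OF c] and step = chainD(2)[OF c]
  define y where "y = v (k - 1)"
  have y: "y \<in> carrier_vec n" using v \<open>0 < k\<close> by (simp add: y_def)
  define p where "p = - (B *\<^sub>v y)"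
  have p: "p \<in> carrier_vec n" using y by (simp add: p_def)
  have p_dot: "p \<bullet> x = y \<bullet> (B *\<^sub>v x)" if "x \<in> carrier_vec n" for x
  proof -
    have "(B *\<^sub>v y) \<bullet> x = x \<bullet> (B *\<^sub>v y)"
      using that y by (intro comm_scalar_prod[of _ n]) auto
    then show ?thesis using swap_B[OF that y] that B by (simp add: p_def)
  qed
  have "0 \<notin> {1..<k}" by simp
  from chain_or_certificate[OF p finite_atLeastLessThan[of 0 k] finite_atLeastLessThan[of 1 k] this]
  show ?thesis
  proof (elim disjE exE conjE)
    fix g
    assume g: "\<forall>i. g i \<in> carrier_vec n" "p \<bullet> g 0 = 1" "\<forall>j\<in>{1..<k}. p \<bullet> g j = 0"
      and g_step: "\<forall>i\<in>{0..<k}. A *\<^sub>v g i = (case i of 0 \<Rightarrow> 0\<^sub>v n | Suc j \<Rightarrow> B *\<^sub>v g j)"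
    have "A *\<^sub>v g (Suc i) = B *\<^sub>v g i" if "Suc i < k" for i
      using bspec[OF g_step, of "Suc i"] that by simp
    then have "chain A B n k g" unfolding chain_def using g(1) by blast
    moreover have "A *\<^sub>v g 0 = 0\<^sub>v n" using bspec[OF g_step, of 0] \<open>0 < k\<close> by simp
    moreover have "v (k - 1) \<bullet> (B *\<^sub>v g j) = (if j = 0 then 1 else 0)" if "j < k" for j
      using p_dot[of "g j"] g that by (cases "j = 0") (auto simp: y_def)
    ultimately show ?thesis by blast
  next
    fix u d
    assume u: "\<forall>i. u i \<in> carrier_vec n" and off: "\<forall>i. i \<notin> {0..<k} \<longrightarrow> u i = 0\<^sub>v n"
      and d: "d 0 = 1" "\<forall>i. i \<noteq> 0 \<longrightarrow> i \<notin> {1..<k} \<longrightarrow> d i = 0"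
      and cert: "\<forall>i. A *\<^sub>v u i + d i \<cdot>\<^sub>v p = B *\<^sub>v u (Suc i)"
    have off_d: "i < k" if "d i \<noteq> 0" for i using d that \<open>0 < k\<close> by (cases "i = 0") auto
    define l where "l = (GREATEST i. d i \<noteq> 0)"
    have "d 0 \<noteq> 0" using d by simp
    then have l: "d l \<noteq> 0" unfolding l_def
      using GreatestI_nat[of "\<lambda>i. d i \<noteq> 0" 0 k] off_d by (meson less_imp_le)
    have l_max: "d i = 0" if "l < i" for i
      using Greatest_le_nat[of "\<lambda>i. d i \<noteq> 0" i k] off_d that unfolding l_def
      by (meson less_imp_le not_le)
    have "l < k" using off_d l by blast
    have cert_above: "A *\<^sub>v u i = B *\<^sub>v u (Suc i)" if "l < i" for i
    proof -
      have "0 \<cdot>\<^sub>v p = 0\<^sub>v n" using p by (intro eq_vecI) auto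
      then show ?thesis using cert[rule_format, of i] l_max[OF that] u by simp
    qed
    have cert_l: "A *\<^sub>v u l = d l \<cdot>\<^sub>v (B *\<^sub>v y) + B *\<^sub>v u (Suc l)"
      unfolding cert[rule_format, of l, symmetric] p_def
      using A B y u by (intro eq_vecI) auto
    \<comment> \<open>Adding the certificate to a multiple of \<open>v\<close> prolongs it by one step, against maximality.\<close>
    define w where "w j = (if j < k then d l \<cdot>\<^sub>v v j + u (l + k - j) else u l)" for j
    have lin: "M *\<^sub>v (a \<cdot>\<^sub>v x + z) = a \<cdot>\<^sub>v (M *\<^sub>v x) + M *\<^sub>v z"
      if "x \<in> carrier_vec n" "z \<in> carrier_vec n" "M \<in> carrier_mat n n" for a :: 'a and x z M
      using that by (simp add: mult_add_distrib_mat_vec[where nr = n and nc = n] mult_mat_vec[where nr = n and nc = n])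
    have "chain A B n (Suc k) w"
      unfolding chain_def
    proof (intro conjI allI impI)
      show "w i \<in> carrier_vec n" for i using u v by (simp add: w_def)
      fix j assume "Suc j < Suc k"
      then have j: "j < k" by simp
      have Bw: "B *\<^sub>v w j = d l \<cdot>\<^sub>v (B *\<^sub>v v j) + B *\<^sub>v u (l + k - j)"
        using j lin[OF v[OF j] _ B] u by (simp add: w_def)
      show "A *\<^sub>v w (Suc j) = B *\<^sub>v w j"
      proof (cases "Suc j = k")
        case True
        then have "l + k - j = Suc l" "v j = y" by (auto simp: y_def)
        then show ?thesis unfolding Bw using cert_l True by (simp add: w_def)
      next
        case False
        then have "Suc j < k" using j by simp
        then have "l < l + k - Suc j" "Suc (l + k - Suc j) = l + k - j" by auto
        then have "A *\<^sub>v u (l + k - Suc j) = B *\<^sub>v u (l + k - j)" using cert_above by metis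
        then show ?thesis
          unfolding Bw using \<open>Suc j < k\<close> lin[OF v[of "Suc j"] _ A] u step[of j] by (simp add: w_def)
      qed
    qed
    moreover have w0: "w 0 = d l \<cdot>\<^sub>v v 0"
      using off v[of 0] \<open>0 < k\<close> by (simp add: w_def)
    moreover have "A *\<^sub>v w 0 = 0\<^sub>v n"
      unfolding w0 using A v[of 0] v0 \<open>0 < k\<close> by (auto simp: mult_mat_vec[where nr = n and nc = n])
    ultimately have "d l \<cdot>\<^sub>v v 0 = 0\<^sub>v n" using max by metis
    then have "v 0 = 0\<^sub>v n"
    proof -
      have "v 0 $ r = 0" if "r < n" for r
      proof -
        have "(d l \<cdot>\<^sub>v v 0) $ r = 0" using \<open>d l \<cdot>\<^sub>v v 0 = 0\<^sub>v n\<close> that by simp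
        then show ?thesis using that v[of 0] \<open>0 < k\<close> l by simp
      qed
      then show ?thesis using v[of 0] \<open>0 < k\<close> by (intro eq_vecI) auto
    qed
    then show ?thesis using v0 by simp
  qed
qed

lemma open_chain_pairing:
  assumes c: "chain A B n k v" and g: "chain A B n k g" and g0: "A *\<^sub>v g 0 = 0\<^sub>v n"
    and top: "\<And>j. j < k \<Longrightarrow> v (k - 1) \<bullet> (B *\<^sub>v g j) = (if j = 0 then 1 else 0)"
    and ij: "i < k" "j < k"
  shows "v i \<bullet> (B *\<^sub>v g j) = (if Suc (i + j) = k then 1 else 0)"
    and "v i \<bullet> (A *\<^sub>v g j) = (if i + j = k then 1 else 0)"
proof -
  note v = chainD(1)[OF c] and step = chainD(2)[OF c]
  note gc = chainD(1)[OF g] and g_step = chainD(2)[OF g]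
  have shift: "v i \<bullet> (B *\<^sub>v g j) = v (Suc i) \<bullet> (A *\<^sub>v g j)" if "Suc i < k" "j < k" for i j
    using that swap_A[OF v[of "Suc i"] gc[of j]] swap_B[OF v[of i] gc[of j]] step[of i] by simp
  have B_pairing: "v i \<bullet> (B *\<^sub>v g j) = (if Suc (i + j) = k then 1 else 0)" if "i < k" "j < k" for i j
    using that
  proof (induction "k - Suc i" arbitrary: i j)
    case 0
    then have "i = k - 1" by simp
    then show ?case using top[of j] 0 by auto
  next
    case (Suc d)
    then have i: "Suc i < k" "d = k - Suc (Suc i)" by auto
    show ?case
    proof (cases j)
      case 0
      then show ?thesis using shift[OF i(1), of 0] g0 v[of "Suc i"] i Suc.prems by simp
    next
      case (Suc j')
      then show ?thesis
        using shift[OF i(1), of j] g_step[of j'] Suc.hyps(1)[of "Suc i" j'] i Suc.prems by simp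
    qed
  qed
  from B_pairing[OF ij] show "v i \<bullet> (B *\<^sub>v g j) = (if Suc (i + j) = k then 1 else 0)" .
  show "v i \<bullet> (A *\<^sub>v g j) = (if i + j = k then 1 else 0)"
  proof (cases j)
    case 0
    then show ?thesis using g0 v[OF ij(1)] ij by simp
  next
    case (Suc j')
    then show ?thesis using g_step[of j'] B_pairing[of i j'] ij by simp
  qed
qed

lemma singular_splits_K_pair:
  assumes no_closed: "\<And>k w. \<not> closed_chain A B n k w"
    and x: "x \<in> carrier_vec n" "A *\<^sub>v x = 0\<^sub>v n" "x \<noteq> 0\<^sub>v n"
  shows "\<exists>k P. 0 < k \<and> 2 * k \<le> n \<and> P \<in> pair_carrier (n - 2 * k) \<and>
    skew_symmetric_mat (fst P) \<and> skew_symmetric_mat (snd P) \<and> congruent_pairs (A, B) (pair_dsum P (K_pair k))"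
proof -
  define open_chain where "open_chain k \<longleftrightarrow> (\<exists>v. chain A B n k v \<and> A *\<^sub>v v 0 = 0\<^sub>v n \<and> v 0 \<noteq> 0\<^sub>v n)" for k
  have "open_chain (Suc 0)"
    unfolding open_chain_def chain_def using x by (intro exI[of _ "\<lambda>_. x"]) simp
  moreover have "\<not> open_chain (Suc n)"
    unfolding open_chain_def using closed_chain_of_long_chain no_closed by blast
  ultimately have "\<exists>k. open_chain (Suc k) \<and> \<not> open_chain (Suc (Suc k))"
    using nat_induct[of "\<lambda>k. open_chain (Suc k)" n] by auto
  then obtain k where k: "0 < k" "open_chain k" "\<not> open_chain (Suc k)" by blast
  then obtain v where c: "chain A B n k v" and v0: "A *\<^sub>v v 0 = 0\<^sub>v n" "v 0 \<noteq> 0\<^sub>v n"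
    unfolding open_chain_def by blast
  from maximal_chain_dual[OF c v0 k(1) k(3)[unfolded open_chain_def]] obtain g where g: "chain A B n k g"
    and g0: "A *\<^sub>v g 0 = 0\<^sub>v n"
    and top: "\<And>j. j < k \<Longrightarrow> v (k - 1) \<bullet> (B *\<^sub>v g j) = (if j = 0 then 1 else 0)" by blast
  note v = chainD(1)[OF c] and step = chainD(2)[OF c]
  note gc = chainD(1)[OF g] and g_step = chainD(2)[OF g]
  note pair = open_chain_pairing[OF c g g0 top]
  define f where "f j = g (k - 1 - j)" for j
  define \<sigma> where "\<sigma> i = B *\<^sub>v f i" for i
  define \<tau> where "\<tau> j = - (B *\<^sub>v v j)" for j
  have f: "f j \<in> carrier_vec n" for j using gc k by (simp add: f_def)
  have \<sigma>: "\<sigma> i \<bullet> x = x \<bullet> (B *\<^sub>v f i)" if "x \<in> carrier_vec n" for i x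
    unfolding \<sigma>_def using that f by (intro comm_scalar_prod[of _ n]) auto
  have \<tau>: "\<tau> j \<bullet> x = v j \<bullet> (B *\<^sub>v x)" if "x \<in> carrier_vec n" "j < k" for j x
  proof -
    have "(B *\<^sub>v v j) \<bullet> x = x \<bullet> (B *\<^sub>v v j)"
      using that v by (intro comm_scalar_prod[of _ n]) auto
    then show ?thesis using swap_B[OF that(1) v[OF that(2)]] that B by (simp add: \<tau>_def)
  qed
  have pair_f: "v i \<bullet> (B *\<^sub>v f j) = (if i = j then 1 else 0)" if "i < k" "j < k" for i j
    using pair(1)[of i "k - 1 - j"] that by (auto simp: f_def)
  have "k + k \<le> n \<and> (\<exists>P\<in>pair_carrier (n - (k + k)). skew_symmetric_mat (fst P) \<and> skew_symmetric_mat (snd P) \<and>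
    congruent_pairs (A, B) (pair_dsum P
      (skew_block (mat k k (\<lambda>(i, j). v i \<bullet> (A *\<^sub>v f j))), skew_block (mat k k (\<lambda>(i, j). v i \<bullet> (B *\<^sub>v f j))))))"
  proof (rule split_isotropic_summand[where \<sigma> = \<sigma> and \<tau> = \<tau>])
    show "v i \<in> carrier_vec n" if "i < k" for i using v that by simp
    show "\<sigma> i \<in> carrier_vec n" for i using f by (simp add: \<sigma>_def)
    show "f j \<in> carrier_vec n" for j by (rule f)
    show "\<tau> j \<in> carrier_vec n" if "j < k" for j using v that by (simp add: \<tau>_def)
    show "\<sigma> i \<bullet> v j = (if i = j then 1 else 0)" if "i < k" "j < k" for i j
      using \<sigma>[OF v[OF that(2)]] pair_f[of j i] that by auto
    show "\<sigma> i \<bullet> f j = 0" for i j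
      using \<sigma>[OF f] chain_isotropic_B[OF g, of "k - 1 - j" "k - 1 - i"] k by (simp add: f_def)
    show "\<tau> i \<bullet> v j = 0" if "i < k" "j < k" for i j
      using \<tau>[OF v[OF that(2)] that(1)] chain_isotropic_B[OF c that] by simp
    show "\<tau> i \<bullet> f j = (if i = j then 1 else 0)" if "i < k" "j < k" for i j
      using \<tau>[OF f that(1)] pair_f[OF that] by simp
    show "v i \<bullet> (A *\<^sub>v v j) = 0 \<and> v i \<bullet> (B *\<^sub>v v j) = 0" if "i < k" "j < k" for i j
      using chain_isotropic_A[OF c that] chain_isotropic_B[OF c that] by simp
    show "f i \<bullet> (A *\<^sub>v f j) = 0 \<and> f i \<bullet> (B *\<^sub>v f j) = 0" for i j
      using chain_isotropic_A[OF g, of "k - 1 - i" "k - 1 - j"]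
        chain_isotropic_B[OF g, of "k - 1 - i" "k - 1 - j"] k by (simp add: f_def)
    fix x assume x: "x \<in> carrier_vec n" and zs: "\<forall>i<k. \<sigma> i \<bullet> x = 0" and zt: "\<forall>j<k. \<tau> j \<bullet> x = 0"
    \<comment> \<open>Along a chain that starts in the kernel of \<open>A\<close>, the form \<open>A\<close> is controlled by \<open>B\<close>.\<close>
    have chain_ann: "w i \<bullet> (A *\<^sub>v x) = 0 \<and> w i \<bullet> (B *\<^sub>v x) = 0"
      if w: "chain A B n k w" "A *\<^sub>v w 0 = 0\<^sub>v n" and z: "\<And>j. j < k \<Longrightarrow> w j \<bullet> (B *\<^sub>v x) = 0" and "i < k"
      for w i
    proof (cases i)
      case 0
      then show ?thesis using swap_A[OF chainD(1)[OF w(1) \<open>i < k\<close>] x] w(2) x z \<open>i < k\<close> by simp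
    next
      case (Suc j)
      then have "x \<bullet> (A *\<^sub>v w i) = x \<bullet> (B *\<^sub>v w j)" using chainD(2)[OF w(1), of j] \<open>i < k\<close> by simp
      then show ?thesis
        using swap_A[OF chainD(1)[OF w(1) \<open>i < k\<close>] x] swap_B[OF chainD(1)[OF w(1), of j] x]
          z[of i] z[of j] Suc \<open>i < k\<close> by simp
    qed
    have "v j \<bullet> (B *\<^sub>v x) = 0" if "j < k" for j using zt \<tau>[OF x that] that by simp
    then have "\<forall>i<k. v i \<bullet> (A *\<^sub>v x) = 0 \<and> v i \<bullet> (B *\<^sub>v x) = 0"
      using chain_ann[OF c v0(1)] by blast
    moreover have "g j \<bullet> (B *\<^sub>v x) = 0" if "j < k" for j
      using zs \<sigma>[OF x, of "k - 1 - j"] swap_B[OF gc[OF that] x] that by (simp add: f_def)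
    then have "\<forall>i<k. g i \<bullet> (A *\<^sub>v x) = 0 \<and> g i \<bullet> (B *\<^sub>v x) = 0"
      using chain_ann[OF g g0] by blast
    ultimately show "(\<forall>i<k. v i \<bullet> (A *\<^sub>v x) = 0 \<and> v i \<bullet> (B *\<^sub>v x) = 0) \<and>
      (\<forall>j<k. f j \<bullet> (A *\<^sub>v x) = 0 \<and> f j \<bullet> (B *\<^sub>v x) = 0)"
      using k(1) by (simp add: f_def)
  qed
  moreover have "mat k k (\<lambda>(i, j). v i \<bullet> (A *\<^sub>v f j)) = sub_jordan_block k"
    unfolding sub_jordan_block_def using pair(2) by (intro eq_matI) (auto simp: f_def)
  moreover have "mat k k (\<lambda>(i, j). v i \<bullet> (B *\<^sub>v f j)) = 1\<^sub>m k"
    using pair_f by (intro eq_matI) auto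
  ultimately have "k + k \<le> n \<and> (\<exists>P\<in>pair_carrier (n - (k + k)). skew_symmetric_mat (fst P) \<and>
    skew_symmetric_mat (snd P) \<and> congruent_pairs (A, B) (pair_dsum P (K_pair k)))"
    by (simp add: K_pair_def)
  then show ?thesis using k(1) unfolding mult_2 by blast
qed

end

section \<open>Regularizing decompositions\<close>

lemma singular_summands_carrier:
  fixes Q :: "'a::field mat_pair"
  assumes "Q \<in> singular_summands"
  obtains k where "Q \<in> pair_carrier k"
proof -
  have block: "skew_block M \<in> carrier_mat (r + c) (r + c)" if "M \<in> carrier_mat r c" for M :: "'a mat" and r c
    using that by (auto simp: skew_block_def)
  have "(J_pair m :: 'a mat_pair) \<in> pair_carrier (m + m)"
    "(K_pair m :: 'a mat_pair) \<in> pair_carrier (m + m)"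
    "(L_pair m :: 'a mat_pair) \<in> pair_carrier (m - 1 + m)" for m
    by (auto simp: J_pair_def K_pair_def L_pair_def pair_carrier_def
      sub_jordan_block_def L_mat_def R_mat_def intro!: block)
  then show thesis
    using assms that unfolding singular_summands_def by blast
qed

lemma (in skew_pair) singular_splits_summand:
  assumes "\<not> invertible_mat A \<or> \<not> invertible_mat B"
  shows "\<exists>m<n. \<exists>P\<in>pair_carrier m. \<exists>Q\<in>singular_summands. skew_symmetric_mat (fst P) \<and>
    skew_symmetric_mat (snd P) \<and> congruent_pairs (A, B) (pair_dsum P Q)"
proof -
  interpret swap: skew_pair B A n
    using A B skew_A skew_B two by unfold_locales
  consider (L) k v where "closed_chain A B n k v"
    | (K) "\<And>k v. \<not> closed_chain A B n k v" "\<not> invertible_mat A"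
    | (J) "\<And>k v. \<not> closed_chain B A n k v" "\<not> invertible_mat B"
    using assms closed_chain_reverse by blast
  then show ?thesis
  proof cases
    case L
    from closed_chain_splits_L_pair[OF L] obtain m P where m: "0 < m" "2 * m - 1 \<le> n"
      and P: "P \<in> pair_carrier (n - (2 * m - 1))" "skew_symmetric_mat (fst P)" "skew_symmetric_mat (snd P)"
        "congruent_pairs (A, B) (pair_dsum P (L_pair m))" by blast
    have "L_pair m \<in> singular_summands" using m by (auto simp: singular_summands_def)
    moreover have "n - (2 * m - 1) < n" using m by simp
    ultimately show ?thesis using P by blast
  next
    case K
    obtain x where "x \<in> carrier_vec n" "x \<noteq> 0\<^sub>v n" "A *\<^sub>v x = 0\<^sub>v n"
      using not_invertible_kernel[OF A K(2)] .
    with singular_splits_K_pair[OF K(1)] obtain m P where m: "0 < m" "2 * m \<le> n"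
      and P: "P \<in> pair_carrier (n - 2 * m)" "skew_symmetric_mat (fst P)" "skew_symmetric_mat (snd P)"
        "congruent_pairs (A, B) (pair_dsum P (K_pair m))" by blast
    have "K_pair m \<in> singular_summands" using m by (auto simp: singular_summands_def)
    moreover have "n - 2 * m < n" using m by simp
    ultimately show ?thesis using P by blast
  next
    case J
    obtain x where "x \<in> carrier_vec n" "x \<noteq> 0\<^sub>v n" "B *\<^sub>v x = 0\<^sub>v n"
      using not_invertible_kernel[OF B J(2)] .
    with swap.singular_splits_K_pair[OF J(1)] obtain m P where m: "0 < m" "2 * m \<le> n"
      and P: "P \<in> pair_carrier (n - 2 * m)" "skew_symmetric_mat (fst P)" "skew_symmetric_mat (snd P)"
        "congruent_pairs (B, A) (pair_dsum P (K_pair m))" by blast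
    have "congruent_pairs (A, B) (pair_dsum (snd P, fst P) (J_pair m))"
      using congruent_pairs_swap[OF P(4)[unfolded pair_dsum_def]]
      by (simp add: pair_dsum_def J_pair_def K_pair_def)
    moreover have "J_pair m \<in> singular_summands" using m by (auto simp: singular_summands_def)
    moreover have "n - 2 * m < n" using m by simp
    moreover have "(snd P, fst P) \<in> pair_carrier (n - 2 * m)" using P(1) by (auto simp: pair_carrier_def)
    ultimately show ?thesis using P(2,3) by (metis fst_conv snd_conv)
  qed
qed

theorem mainTheorem1:
  fixes A B :: "'a::field mat" and n :: nat
  assumes "CHAR('a) \<noteq> 2"
    and "A \<in> carrier_mat n n" and "B \<in> carrier_mat n n"
    and "skew_symmetric_mat A" and "skew_symmetric_mat B"
  shows "\<exists>A0 B0 Ps. regularizing_decomposition (A, B) (A0, B0) Ps"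
proof -
  have two: "(2 :: 'a) \<noteq> 0"
  proof
    assume "(2 :: 'a) = 0"
    then have "of_nat 2 = (0 :: 'a)" by simp
    then have "CHAR('a) dvd 2" by (simp only: of_nat_eq_0_iff_char_dvd)
    then have "CHAR('a) \<le> 2" by (rule dvd_imp_le) simp
    moreover have "CHAR('a) \<noteq> 0" using \<open>CHAR('a) dvd 2\<close> by (metis dvd_0_left zero_neq_numeral)
    moreover have "CHAR('a) \<noteq> 1" by simp
    ultimately show False using assms(1) by linarith
  qed
  show ?thesis
    using assms(2-5)
  proof (induction n arbitrary: A B rule: less_induct)
    case (less n)
    interpret skew_pair A B n
      using less.prems two by unfold_locales (auto simp: skew_symmetric_mat_def)
    show ?case
    proof (cases "invertible_mat A \<and> invertible_mat B")
      case True
      have "(A, B) \<in> pair_carrier n" using A B by (simp add: pair_carrier_def)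
      then have "regularizing_decomposition (A, B) (A, B) []"
        unfolding regularizing_decomposition_def using True congruent_pairs_refl by auto
      then show ?thesis by blast
    next
      case False
      then obtain m P Q where "m < n" and P: "P \<in> pair_carrier m" and Q: "Q \<in> singular_summands"
        and skew: "skew_symmetric_mat (fst P)" "skew_symmetric_mat (snd P)"
        and cong: "congruent_pairs (A, B) (pair_dsum P Q)"
        using singular_splits_summand by blast
      have "fst P \<in> carrier_mat m m" "snd P \<in> carrier_mat m m" using P by (auto simp: pair_carrier_def)
      from less.IH[OF \<open>m < n\<close> this skew] obtain A0 B0 Ps
        where reg: "regularizing_decomposition P (A0, B0) Ps" by auto
      obtain k where "Q \<in> pair_carrier k" using singular_summands_carrier[OF Q] .
      moreover have "congruent_pairs P (foldl pair_dsum (A0, B0) Ps)"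
        using reg unfolding regularizing_decomposition_def by blast
      ultimately have "congruent_pairs (pair_dsum P Q) (foldl pair_dsum (A0, B0) (Ps @ [Q]))"
        using congruent_pairs_dsum_left by simp
      then have "regularizing_decomposition (A, B) (A0, B0) (Ps @ [Q])"
        using reg Q congruent_pairs_trans[OF cong] unfolding regularizing_decomposition_def by auto
      then show ?thesis by blast
    qed
  qed
qed

end
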